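(* Let $\alpha\in(0,\frac12)$. There exists $\beta_0<\infty$ such that for all $\beta>\beta_0$, $h_c(\beta)>h_c^a(\beta)$.
   Context: Let $\tau=(\tau_n)_{n\ge 0}$ be a recurrent renewal process with $\tau_0=0$ and law $P$ (expectation $E$), i.e. the increments $T_k=\tau_k-\tau_{k-1}$, $k\ge1$, are i.i.d. with values in $\{1,2,\ldots\}$ and $$K(n)=P(\tau_1=n)=L(n)\,n^{-(1+\alpha)},\qquad \sum_{n\ge1}K(n)=1,$$ where $L$ is a (positive) slowly varying function. Write $\delta_n=\mathbf 1_{\{n\in\tau\}}$. Independently of $\tau$, let $\omega=(\omega_n)_{n\in\mathbb Z}$ be a stationary Gaussian process with law $\mathbb P$ (expectation $\mathbb E$), mean $0$ and variance $1$, and correlations $\rho_n=\operatorname{Cov}(\omega_0,\omega_n)$. Assume finite range correlations: there is an integer $q\ge1$ such that $\rho_n=0$ for all $n>q$. For $\beta\ge0$, $h\in\mathbb R$, $n\ge1$, set $H_n=\sum_{k=1}^n(\beta\omega_k+h)\delta_k$, $Z_{n,\beta,h,\omega}=E(\exp(H_n)\delta_n)$ (quenched partition function) and $Z^a_{n,\beta,h}=\mathbb E Z_{n,\beta,h,\omega}$ (annealed partition function). The quenched and annealed free energies are $$F(\beta,h)=\lim_{n\to\infty}\frac1n\log Z_{n,\beta,h,\omega}\ge 0,\qquad F^a(\beta,h)=\lim_{n\to\infty}\frac1n\log Z^a_{n,\beta,h}\ge 0,$$ where the first limit is $\mathbb P$-almost sure and in $L^1(\mathbb P)$ (these limits are known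 to exist and $F$ is nonrandom). The quenched and annealed critical points are $h_c(\beta)=\sup\{h\in\mathbb R:F(\beta,h)=0\}$ and $h_c^a(\beta)=\sup\{h\in\mathbb R:F^a(\beta,h)=0\}$. *)

theory Defs
  imports "HOL-Probability.Probability"
begin

definition slowly_varying :: "(real \<Rightarrow> real) \<Rightarrow> bool" where
  "slowly_varying L \<longleftrightarrow>
     L \<in> borel_measurable (restrict_space borel {0<..}) \<and>
     (\<forall>x>0. L x > 0) \<and>
     (\<forall>c>0. ((\<lambda>x. L (c * x) / L x) \<longlongrightarrow> 1) at_top)"

text \<open>Since the points \<open>\<tau> k x\<close> are strictly increasing in \<open>k\<close>, the truncated
  difference on \<^typ>\<open>nat\<close> below is the true increment.\<close>

definition renewal_process ::
  "'a measure \<Rightarrow> (nat \<Rightarrow> 'a \<Rightarrow> nat) \<Rightarrow> (nat \<Rightarrow> real) \<Rightarrow> bool" where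
  "renewal_process P \<tau> K \<longleftrightarrow>
     prob_space P \<and>
     (\<forall>k. \<tau> k \<in> measurable P (count_space UNIV)) \<and>
     (\<forall>x\<in>space P. \<tau> 0 x = 0) \<and>
     (\<forall>x\<in>space P. \<forall>k. \<tau> k x < \<tau> (Suc k) x) \<and>
     prob_space.indep_vars P (\<lambda>_. count_space UNIV) (\<lambda>k x. \<tau> (Suc k) x - \<tau> k x) UNIV \<and>
     (\<forall>k. \<forall>n\<ge>1. measure P {x \<in> space P. \<tau> (Suc k) x - \<tau> k x = n} = K n)"

text \<open>A process is Gaussian iff every finite linear combination of its coordinates is normal,
  where normal laws of variance zero (point masses) are allowed.\<close>

definition gaussian_rv :: "'b measure \<Rightarrow> ('b \<Rightarrow> real) \<Rightarrow> bool" where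
  "gaussian_rv M X \<longleftrightarrow>
     X \<in> borel_measurable M \<and>
     (\<exists>\<mu>. (AE y in M. X y = \<mu>) \<or> (\<exists>\<sigma>>0. distributed M lborel X (normal_density \<mu> \<sigma>)))"

definition gaussian_process :: "'b measure \<Rightarrow> (int \<Rightarrow> 'b \<Rightarrow> real) \<Rightarrow> bool" where
  "gaussian_process M \<omega> \<longleftrightarrow>
     (\<forall>n. \<omega> n \<in> borel_measurable M) \<and>
     (\<forall>I c. finite I \<longrightarrow> gaussian_rv M (\<lambda>y. \<Sum>i\<in>I. c i * \<omega> i y))"

definition stationary_process :: "'b measure \<Rightarrow> (int \<Rightarrow> 'b \<Rightarrow> real) \<Rightarrow> bool" where
  "stationary_process M \<omega> \<longleftrightarrow>
     (\<forall>m. distr M (PiM UNIV (\<lambda>_. borel)) (\<lambda>y n. \<omega> (n + m) y)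
        = distr M (PiM UNIV (\<lambda>_. borel)) (\<lambda>y n. \<omega> n y))"

definition covariance :: "'b measure \<Rightarrow> ('b \<Rightarrow> real) \<Rightarrow> ('b \<Rightarrow> real) \<Rightarrow> real" where
  "covariance M X Y =
     (\<integral>y. (X y - (\<integral>z. X z \<partial>M)) * (Y y - (\<integral>z. Y z \<partial>M)) \<partial>M)"

definition renewal_delta :: "(nat \<Rightarrow> 'a \<Rightarrow> nat) \<Rightarrow> nat \<Rightarrow> 'a \<Rightarrow> real" where
  "renewal_delta \<tau> n x = (if n \<in> range (\<lambda>k. \<tau> k x) then 1 else 0)"

definition hamiltonian ::
  "(nat \<Rightarrow> 'a \<Rightarrow> nat) \<Rightarrow> nat \<Rightarrow> real \<Rightarrow> real \<Rightarrow> (int \<Rightarrow> real) \<Rightarrow> 'a \<Rightarrow> real" where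
  "hamiltonian \<tau> n \<beta> h w x = (\<Sum>k=1..n. (\<beta> * w (int k) + h) * renewal_delta \<tau> k x)"

text \<open>The disorder lives on its own probability space \<open>M\<close>, and the renewal process on \<open>P\<close>;
  integrating over \<open>P\<close> for a frozen realisation \<open>w\<close> and then over \<open>M\<close> is integration against
  the product of the two laws, i.e. the disorder and the renewal process are independent.\<close>

definition quenched_Z ::
  "'a measure \<Rightarrow> (nat \<Rightarrow> 'a \<Rightarrow> nat) \<Rightarrow> nat \<Rightarrow> real \<Rightarrow> real \<Rightarrow> (int \<Rightarrow> real) \<Rightarrow> real" where
  "quenched_Z P \<tau> n \<beta> h w =
     (\<integral>x. exp (hamiltonian \<tau> n \<beta> h w x) * renewal_delta \<tau> n x \<partial>P)"

definition annealed_Z ::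
  "'a measure \<Rightarrow> (nat \<Rightarrow> 'a \<Rightarrow> nat) \<Rightarrow> 'b measure \<Rightarrow> (int \<Rightarrow> 'b \<Rightarrow> real)
     \<Rightarrow> nat \<Rightarrow> real \<Rightarrow> real \<Rightarrow> real" where
  "annealed_Z P \<tau> M \<omega> n \<beta> h = (\<integral>y. quenched_Z P \<tau> n \<beta> h (\<lambda>k. \<omega> k y) \<partial>M)"

text \<open>\<open>f\<close> is the nonrandom limit, almost surely and in \<open>L\<^sup>1\<close>, defining the quenched free
  energy at \<open>(\<beta>, h)\<close>.\<close>

definition is_quenched_free_energy ::
  "'a measure \<Rightarrow> (nat \<Rightarrow> 'a \<Rightarrow> nat) \<Rightarrow> 'b measure \<Rightarrow> (int \<Rightarrow> 'b \<Rightarrow> real)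
     \<Rightarrow> real \<Rightarrow> real \<Rightarrow> real \<Rightarrow> bool" where
  "is_quenched_free_energy P \<tau> M \<omega> \<beta> h f \<longleftrightarrow>
     (AE y in M. (\<lambda>n. ln (quenched_Z P \<tau> n \<beta> h (\<lambda>k. \<omega> k y)) / real n) \<longlonglongrightarrow> f) \<and>
     (\<forall>n\<ge>1. integrable M (\<lambda>y. ln (quenched_Z P \<tau> n \<beta> h (\<lambda>k. \<omega> k y)) / real n)) \<and>
     (\<lambda>n. \<integral>y. \<bar>ln (quenched_Z P \<tau> n \<beta> h (\<lambda>k. \<omega> k y)) / real n - f\<bar> \<partial>M) \<longlonglongrightarrow> 0"

definition is_annealed_free_energy ::
  "'a measure \<Rightarrow> (nat \<Rightarrow> 'a \<Rightarrow> nat) \<Rightarrow> 'b measure \<Rightarrow> (int \<Rightarrow> 'b \<Rightarrow> real)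
     \<Rightarrow> real \<Rightarrow> real \<Rightarrow> real \<Rightarrow> bool" where
  "is_annealed_free_energy P \<tau> M \<omega> \<beta> h f \<longleftrightarrow>
     (\<lambda>n. ln (annealed_Z P \<tau> M \<omega> n \<beta> h) / real n) \<longlonglongrightarrow> f"

definition critical_point :: "(real \<Rightarrow> real \<Rightarrow> real) \<Rightarrow> real \<Rightarrow> real" where
  "critical_point F \<beta> = Sup {h. F \<beta> h = 0}"

end

theory Submission
  imports Defs
begin

text \<open>
  Both critical points are of order \<open>- \<beta>\<^sup>2\<close> when \<open>\<beta>\<close> is large, and the leading coefficients differ.
  A trajectory of the renewal process that visits the sites of a set \<open>I\<close> collects the disorder
  \<open>\<Sum>i\<in>I. \<omega> i\<close>. Let \<open>v\<close> be the supremum, over finite nonempty sets of sites, of its variance per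
  visited point; it is finite because the correlations have finite range, and at least \<open>1\<close>.

  Annealed upper bound. A trajectory made of copies of one finite block of gaps, whose first gap
  exceeds the correlation range, sees independent disorder in each copy. If the block has \<open>s\<close> points
  and variance \<open>V\<close>, such trajectories contribute a factor \<open>exp (\<beta>\<^sup>2 V / 2 + h s)\<close> per block,
  times the renewal probability of the block. Hence the annealed critical point is at most
  \<open>- (V / s) \<beta>\<^sup>2 / 2\<close> plus a constant that depends on the block only
  (\<open>annealed_critical_point_le\<close>), and \<open>V / s\<close> may be chosen as close to \<open>v\<close> as desired
  (\<open>exists_dense_block\<close>).

  Quenched lower bound. Fix \<open>\<gamma> < 1\<close> for which the sum of \<open>K n powr \<gamma>\<close> converges. By subadditivity of
  the power, the moment of order \<open>\<gamma>\<close> of the partition function is at most the sum over trajectories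
  of the products of the \<open>K n powr \<gamma>\<close> times \<open>exp (\<gamma>\<^sup>2 \<beta>\<^sup>2 v / 2 + \<gamma> h)\<close> per visited point. This
  is at most \<open>1\<close>, and then the quenched free energy vanishes, as soon as
  \<open>h \<le> - \<gamma> v \<beta>\<^sup>2 / 2 - c\<close> for a constant \<open>c\<close> (\<open>quenched_critical_point_ge\<close>).

  Choosing a block with \<open>V / s > \<gamma> v\<close> separates the two bounds for all large \<open>\<beta>\<close>.

  The existence of \<open>\<gamma>\<close> requires that the slowly varying factor of \<open>K\<close> is dominated by every power.
  This is derived from measurability and pointwise convergence by an argument on Lebesgue measure
  (\<open>slowly_varying_log_le\<close>).
\<close>

section \<open>Growth of slowly varying functions\<close>

lemma slowly_varying_log_increment_tendsto_0:
  assumes "slowly_varying L"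
  shows "((\<lambda>x. ln (L (exp (x + u))) - ln (L (exp x))) \<longlongrightarrow> 0) at_top"
proof -
  have Lpos: "\<And>x. x > 0 \<Longrightarrow> L x > 0"
    and Llim: "\<And>c. c > 0 \<Longrightarrow> ((\<lambda>x. L (c * x) / L x) \<longlongrightarrow> 1) at_top"
    using assms unfolding slowly_varying_def by auto
  have "((\<lambda>x. L (exp u * exp x) / L (exp x)) \<longlongrightarrow> 1) at_top"
    using filterlim_compose[OF Llim[of "exp u"] exp_at_top] by simp
  from tendsto_ln[OF this] have "((\<lambda>x. ln (L (exp u * exp x) / L (exp x))) \<longlongrightarrow> 0) at_top"
    by simp
  also have "(\<lambda>x. ln (L (exp u * exp x) / L (exp x))) = (\<lambda>x. ln (L (exp (x + u))) - ln (L (exp x)))"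
  proof
    show "ln (L (exp u * exp x) / L (exp x)) = ln (L (exp (x + u))) - ln (L (exp x))" for x
      using Lpos[of "exp u * exp x"] Lpos[of "exp x"] by (simp add: ln_div exp_add mult.commute)
  qed
  finally show ?thesis .
qed

text \<open>This is the part of the uniform convergence theorem that is needed. The offsets \<open>t\<close> for which
  \<open>f (x + t)\<close> is far from \<open>f x\<close> form a set of vanishing measure, so for large \<open>x\<close> two such sets, one seen
  from \<open>x\<close> and one from \<open>x + u\<close>, cannot cover an interval of length one: some common point is close to
  both values. This is where the measurability of \<open>L\<close> enters.\<close>

lemma slowly_varying_log_increment_bounded:
  assumes "slowly_varying L"
  defines "f \<equiv> \<lambda>x. ln (L (exp x))"
  shows "\<exists>X. \<forall>x\<ge>X. \<forall>u\<in>{0..1}. \<bar>f (x + u) - f x\<bar> < 2"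
proof -
  have Lm: "L \<in> borel_measurable (restrict_space borel {0<..})"
    using assms(1) unfolding slowly_varying_def by auto
  have "(exp :: real \<Rightarrow> real) \<in> measurable borel (restrict_space borel {0<..})"
    by (intro measurable_restrict_space2) auto
  from measurable_compose[OF this Lm] have [measurable]: "f \<in> borel_measurable borel"
    unfolding f_def by measurable
  have flim: "((\<lambda>x. f (x + u) - f x) \<longlongrightarrow> 0) at_top" for u
    unfolding f_def by (rule slowly_varying_log_increment_tendsto_0[OF assms(1)])
  \<comment> \<open>The bad offsets at \<open>x\<close>; their measure tends to \<open>0\<close> by dominated convergence.\<close>
  define bad where "bad x = {t\<in>{0..2}. 1 \<le> \<bar>f (x + t) - f x\<bar>}" for x
  have bad_sets[measurable]: "bad x \<in> sets borel" for x
    unfolding bad_def by measurable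
  have "((\<lambda>x. \<integral>t. indicator (bad x) t \<partial>lborel) \<longlongrightarrow> (\<integral>t. (0::real) \<partial>(lborel::real measure))) at_top"
  proof (rule integral_dominated_convergence_at_top[where w="indicator {0..2::real}"])
    show "AE t in lborel. ((\<lambda>x. indicator (bad x) t :: real) \<longlongrightarrow> 0) at_top"
    proof (rule AE_I2)
      fix t :: real
      have "eventually (\<lambda>x. \<bar>f (x + t) - f x\<bar> < 1) at_top"
        using tendstoD[OF flim[of t], of 1] by (simp add: dist_real_def)
      then show "((\<lambda>x. indicator (bad x) t :: real) \<longlongrightarrow> 0) at_top"
        by (intro tendsto_eventually) (auto elim!: eventually_mono simp: bad_def indicator_def)
    qed
    show "\<forall>\<^sub>F x in at_top. AE t in lborel. norm (indicator (bad x) t :: real) \<le> indicator {0..2} t"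
      by (intro always_eventually allI AE_I2) (auto simp: bad_def indicator_def)
  qed auto
  then have "((\<lambda>x. measure lebesgue (bad x)) \<longlongrightarrow> 0) at_top"
    by simp
  from order_tendstoD(2)[OF this, of "1/2"] obtain X where
    X: "\<And>x. x \<ge> X \<Longrightarrow> measure lebesgue (bad x) < 1/2"
    by (auto simp: eventually_at_top_linorder)
  have bad_lm: "bad x \<in> lmeasurable" for x
    by (rule bounded_set_imp_lmeasurable)
      (auto simp: bad_def intro: bounded_subset[of "{0..2::real}"])
  have "\<bar>f (x + u) - f x\<bar> < 2" if x: "x \<ge> X" and u: "u \<in> {0..1}" for x u
  proof (rule ccontr)
    assume *: "\<not> \<bar>f (x + u) - f x\<bar> < 2"
    \<comment> \<open>A point \<open>x + t\<close> that is good seen from both \<open>x\<close> and \<open>x + u\<close> would link the two values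
      of \<open>f\<close>, so the two bad sets cover an interval of length \<open>1\<close>.\<close>
    have "{1..2} \<subseteq> bad x \<union> (+) u ` bad (x + u)"
    proof
      fix t :: real assume t: "t \<in> {1..2}"
      show "t \<in> bad x \<union> (+) u ` bad (x + u)"
      proof (rule ccontr)
        assume n: "t \<notin> bad x \<union> (+) u ` bad (x + u)"
        then have "\<bar>f (x + t) - f x\<bar> < 1" using t by (auto simp: bad_def)
        moreover have "t - u \<notin> bad (x + u)"
          using n by (metis UnI2 add.commute diff_add_cancel image_eqI)
        then have "\<bar>f (x + t) - f (x + u)\<bar> < 1" using t u by (auto simp: bad_def)
        ultimately show False using * by linarith
      qed
    qed
    then have "measure lebesgue {1..2::real} \<le> measure lebesgue (bad x \<union> (+) u ` bad (x + u))"
      by (intro measure_mono_fmeasurable) (auto intro!: fmeasurable.Un bad_lm measurable_translation)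
    also have "\<dots> \<le> measure lebesgue (bad x) + measure lebesgue ((+) u ` bad (x + u))"
      by (intro measure_Un_le fmeasurableD bad_lm measurable_translation)
    also have "\<dots> = measure lebesgue (bad x) + measure lebesgue (bad (x + u))"
      by (simp only: measure_translation)
    also have "\<dots> < 1"
      using X[OF x] X[of "x + u"] x u by auto
    finally show False by simp
  qed
  then show ?thesis by blast
qed

text \<open>A weak form of Potter's bounds: in logarithmic scale the unit increments tend to \<open>0\<close>, so the
  function grows sublinearly along integer steps, and the previous lemma fills the gaps.\<close>

lemma slowly_varying_log_le:
  assumes "slowly_varying L" and "\<epsilon> > 0"
  shows "\<exists>A. eventually (\<lambda>x. \<bar>ln (L x)\<bar> \<le> A + \<epsilon> * ln x) at_top"
proof -
  define f where "f x = ln (L (exp x))" for x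
  obtain X1 where X1: "\<And>x u. x \<ge> X1 \<Longrightarrow> u \<in> {0..1} \<Longrightarrow> \<bar>f (x + u) - f x\<bar> < 2"
    using slowly_varying_log_increment_bounded[OF assms(1)] unfolding f_def by blast
  have "((\<lambda>x. f (x + 1) - f x) \<longlongrightarrow> 0) at_top"
    unfolding f_def by (rule slowly_varying_log_increment_tendsto_0[OF assms(1)])
  from tendstoD[OF this assms(2)] obtain X2 where
    X2: "\<And>x. x \<ge> X2 \<Longrightarrow> \<bar>f (x + 1) - f x\<bar> < \<epsilon>"
    by (auto simp: eventually_at_top_linorder dist_real_def)
  define X where "X = max 0 (max X1 X2)"
  have step: "\<bar>f (X + real k)\<bar> \<le> \<bar>f X\<bar> + \<epsilon> * real k" for k
  proof (induction k)
    case (Suc k)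
    have "\<bar>f (X + real k + 1) - f (X + real k)\<bar> < \<epsilon>"
      by (rule X2) (auto simp: X_def)
    with Suc show ?case by (simp add: algebra_simps)
  qed simp
  have linear: "\<bar>f x\<bar> \<le> \<bar>f X\<bar> + 2 + \<epsilon> * x" if x: "x \<ge> X" for x
  proof -
    define k where "k = nat \<lfloor>x - X\<rfloor>"
    define u where "u = x - X - real k"
    have k: "real k \<le> x - X" "x - X < real k + 1"
      using x by (simp_all add: k_def)
    have "\<bar>f (X + real k + u) - f (X + real k)\<bar> < 2"
      by (rule X1) (use k in \<open>auto simp: X_def u_def\<close>)
    moreover have "X + real k + u = x" by (simp add: u_def)
    moreover have "\<epsilon> * real k \<le> \<epsilon> * x"
      using k assms(2) by (intro mult_left_mono) (auto simp: X_def)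
    ultimately show ?thesis using step[of k] by (simp add: algebra_simps)
  qed
  have *: "\<bar>ln (L x)\<bar> \<le> \<bar>f X\<bar> + 2 + \<epsilon> * ln x" if "x \<ge> exp X" for x
  proof -
    have x: "x > 0" using that less_le_trans[OF exp_gt_zero] by blast
    then have "X \<le> ln x" using that by (simp add: ln_ge_iff)
    then have "\<bar>f (ln x)\<bar> \<le> \<bar>f X\<bar> + 2 + \<epsilon> * ln x"
      by (rule linear)
    then show ?thesis using x by (simp add: f_def)
  qed
  show ?thesis
    by (rule exI[of _ "\<bar>f X\<bar> + 2"]) (use * in \<open>auto simp: eventually_at_top_linorder\<close>)
qed

text \<open>The exponent must satisfy \<open>\<gamma> (1 + \<alpha>) > 1\<close>, with some room to absorb the slowly varying factor;
  this is possible with \<open>\<gamma> < 1\<close> because \<open>\<alpha> > 0\<close>.\<close>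

lemma regularly_varying_powr_summable:
  assumes L: "slowly_varying L" and "\<alpha> > 0"
    and K: "\<And>n. n \<ge> 1 \<Longrightarrow> K n = L (real n) * real n powr (- (1 + \<alpha>))"
  shows "\<exists>\<gamma>\<in>{0<..<1}. summable (\<lambda>n. K (Suc n) powr \<gamma>)"
proof -
  define \<gamma> where "\<gamma> = (1 + \<alpha>/4) / (1 + \<alpha>/2)"
  have \<gamma>: "0 < \<gamma>" "\<gamma> < 1" "\<gamma> * (1 + \<alpha>/2) = 1 + \<alpha>/4"
    using \<open>\<alpha> > 0\<close> by (auto simp: \<gamma>_def field_simps)
  have Lpos: "\<And>x. x > 0 \<Longrightarrow> L x > 0"
    using assms(1) unfolding slowly_varying_def by auto
  obtain A where "eventually (\<lambda>x. \<bar>ln (L x)\<bar> \<le> A + \<alpha>/2 * ln x) at_top"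
    using slowly_varying_log_le[OF L, of "\<alpha>/2"] \<open>\<alpha> > 0\<close> by auto
  then have "eventually (\<lambda>n. \<bar>ln (L (real n))\<bar> \<le> A + \<alpha>/2 * ln (real n)) sequentially"
    by (rule eventually_compose_filterlim) (rule filterlim_real_sequentially)
  then have "eventually (\<lambda>n. norm (K n powr \<gamma>) \<le> exp (\<gamma> * A) * real n powr (- (1 + \<alpha>/4))) sequentially"
    using eventually_ge_at_top[of 1]
  proof eventually_elim
    case (elim n)
    have "K n powr \<gamma> = exp (\<gamma> * (ln (L (real n)) - (1 + \<alpha>) * ln (real n)))"
      using elim Lpos[of "real n"] by (simp add: K powr_def ln_mult algebra_simps)
    also have "\<dots> \<le> exp (\<gamma> * (A - (1 + \<alpha>/2) * ln (real n)))"
    proof -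
      have "ln (L (real n)) - (1 + \<alpha>) * ln (real n) \<le> A - (1 + \<alpha>/2) * ln (real n)"
        using elim by (simp add: algebra_simps)
      then show ?thesis using mult_left_mono[OF _ less_imp_le[OF \<gamma>(1)]] by simp
    qed
    also have "\<gamma> * (A - (1 + \<alpha>/2) * ln (real n)) = \<gamma> * A - (\<gamma> * (1 + \<alpha>/2)) * ln (real n)"
      by (simp only: right_diff_distrib mult.assoc)
    also have "\<dots> = \<gamma> * A + (- (1 + \<alpha>/4)) * ln (real n)"
      unfolding \<gamma>(3) by (simp only: minus_mult_left diff_conv_add_uminus)
    finally show ?case using elim by (simp add: powr_def exp_add)
  qed
  moreover have "summable (\<lambda>n. exp (\<gamma> * A) * real n powr (- (1 + \<alpha>/4)))"
    using \<open>\<alpha> > 0\<close> by (intro summable_mult) (simp add: summable_real_powr_iff)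
  ultimately have "summable (\<lambda>n. K n powr \<gamma>)"
    by (rule summable_comparison_test_ev)
  then have "summable (\<lambda>n. K (Suc n) powr \<gamma>)"
    by (subst summable_Suc_iff)
  then show ?thesis using \<gamma> by auto
qed

lemma regularly_varying_log_tendsto_0:
  assumes L: "slowly_varying L"
    and K: "\<And>n. n \<ge> 1 \<Longrightarrow> K n = L (real n) * real n powr (- (1 + \<alpha>))"
  shows "(\<lambda>n. ln (K n) / real n) \<longlonglongrightarrow> 0"
proof -
  have Lpos: "\<And>x. x > 0 \<Longrightarrow> L x > 0"
    using assms(1) unfolding slowly_varying_def by auto
  obtain A where "eventually (\<lambda>x. \<bar>ln (L x)\<bar> \<le> A + 1 * ln x) at_top"
    using slowly_varying_log_le[OF L, of 1] by auto
  then have "eventually (\<lambda>n. \<bar>ln (L (real n))\<bar> \<le> A + 1 * ln (real n)) sequentially"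
    by (rule eventually_compose_filterlim) (rule filterlim_real_sequentially)
  then have "eventually (\<lambda>n. norm (ln (K n) / real n) \<le> A / real n + (1 + \<bar>1 + \<alpha>\<bar>) * (ln (real n) / real n)) sequentially"
    using eventually_ge_at_top[of 1]
  proof eventually_elim
    case (elim n)
    have "ln (K n) = ln (L (real n)) - (1 + \<alpha>) * ln (real n)"
      using elim Lpos[of "real n"] by (simp add: K powr_def ln_mult algebra_simps)
    also have "\<bar>\<dots>\<bar> \<le> \<bar>ln (L (real n))\<bar> + \<bar>1 + \<alpha>\<bar> * ln (real n)"
      using elim abs_triangle_ineq4[of "ln (L (real n))" "(1 + \<alpha>) * ln (real n)"] by (simp add: abs_mult)
    also have "\<dots> \<le> A + (1 + \<bar>1 + \<alpha>\<bar>) * ln (real n)" using elim by (simp add: algebra_simps)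
    finally have "\<bar>ln (K n)\<bar> / real n \<le> (A + (1 + \<bar>1 + \<alpha>\<bar>) * ln (real n)) / real n"
      by (rule divide_right_mono) simp
    then show ?case by (simp add: add_divide_distrib)
  qed
  moreover have "(\<lambda>n. A / real n + (1 + \<bar>1 + \<alpha>\<bar>) * (ln (real n) / real n)) \<longlonglongrightarrow> 0 + (1 + \<bar>1 + \<alpha>\<bar>) * 0"
    by (intro tendsto_intros lim_const_over_n lim_ln_over_n)
  then have "(\<lambda>n. A / real n + (1 + \<bar>1 + \<alpha>\<bar>) * (ln (real n) / real n)) \<longlonglongrightarrow> 0"
    by simp
  ultimately show ?thesis
    by (rule Lim_null_comparison)
qed

section \<open>Renewal trajectories as compositions\<close>

text \<open>A renewal trajectory that visits \<open>n\<close> is encoded by the list of its gaps, which is a composition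
  of \<open>n\<close>; the points that it visits in \<open>{1..n}\<close> are the partial sums started at \<open>0\<close>.\<close>

definition compositions :: "nat \<Rightarrow> nat list set" where
  "compositions n = {l. sum_list l = n \<and> 0 \<notin> set l}"

fun partial_sums :: "nat \<Rightarrow> nat list \<Rightarrow> nat list" where
  "partial_sums a [] = []"
| "partial_sums a (x # l) = (a + x) # partial_sums (a + x) l"

lemma length_partial_sums [simp]: "length (partial_sums a l) = length l"
  by (induction l arbitrary: a) auto

lemma partial_sums_append:
  "partial_sums a (l @ l') = partial_sums a l @ partial_sums (a + sum_list l) l'"
  by (induction l arbitrary: a) (auto simp: add.assoc)

lemma partial_sums_shift: "partial_sums (a + b) l = map ((+) a) (partial_sums b l)"
  by (induction l arbitrary: b) (auto simp: add.assoc)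

lemma partial_sums_bounds:
  assumes "0 \<notin> set l" "x \<in> set (partial_sums a l)"
  shows "a < x \<and> x \<le> a + sum_list l"
  using assms by (induction l arbitrary: a) (fastforce)+

lemma distinct_partial_sums: "0 \<notin> set l \<Longrightarrow> distinct (partial_sums a l)"
  by (induction l arbitrary: a) (auto dest: partial_sums_bounds)

lemma finite_compositions: "finite (compositions n)"
proof (rule finite_subset)
  have "length l \<le> sum_list l" if "0 \<notin> set l" for l :: "nat list"
    using that by (induction l) auto
  then show "compositions n \<subseteq> {l. set l \<subseteq> {..n} \<and> length l \<le> n}"
    by (auto simp: compositions_def member_le_sum_list)
qed (rule finite_lists_length_le, simp)

lemma compositions_0: "compositions 0 = {[]}"
proof -
  have "l = []" if "sum_list l = 0" "0 \<notin> set l" for l :: "nat list"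
    using that by (cases l) auto
  then show ?thesis by (auto simp: compositions_def)
qed

lemma compositions_rec:
  assumes "n > 0"
  shows "compositions n = (\<Union>m\<in>{1..n}. (#) m ` compositions (n - m))"
proof (intro equalityI subsetI)
  fix l assume l: "l \<in> compositions n"
  then obtain m l' where "l = m # l'" using assms by (cases l) (auto simp: compositions_def)
  then show "l \<in> (\<Union>m\<in>{1..n}. (#) m ` compositions (n - m))"
    using l by (auto simp: compositions_def intro!: bexI[of _ m] Suc_leI)
qed (use assms in \<open>auto simp: compositions_def\<close>)

text \<open>The sum is the probability that a (possibly terminating) renewal process with gap law \<open>g\<close> visits
  \<open>n\<close>. Splitting off the first gap gives the renewal equation, from which the bound follows by
  induction.\<close>

lemma sum_compositions_le_1:
  fixes g :: "nat \<Rightarrow> real"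
  assumes nonneg: "\<And>m. m \<ge> 1 \<Longrightarrow> g m \<ge> 0" and le: "\<And>n. (\<Sum>m=1..n. g m) \<le> 1"
  shows "(\<Sum>l\<in>compositions n. prod_list (map g l)) \<le> 1"
proof (induction n rule: less_induct)
  case (less n)
  show ?case
  proof (cases "n = 0")
    case False
    have "(\<Sum>l\<in>compositions n. prod_list (map g l))
        = (\<Sum>m=1..n. \<Sum>l\<in>(#) m ` compositions (n - m). prod_list (map g l))"
      unfolding compositions_rec[OF False[THEN neq0_conv[THEN iffD1]]]
      by (intro sum.UNION_disjoint) (auto simp: finite_compositions)
    also have "\<dots> = (\<Sum>m=1..n. g m * (\<Sum>l\<in>compositions (n - m). prod_list (map g l)))"
      by (intro sum.cong refl) (simp add: sum.reindex sum_distrib_left)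
    also have "\<dots> \<le> (\<Sum>m=1..n. g m * 1)"
      by (intro sum_mono mult_left_mono less nonneg) auto
    finally show ?thesis using le[of n] by simp
  qed (simp add: compositions_0)
qed

locale renewal =
  fixes P :: "'a measure" and \<tau> :: "nat \<Rightarrow> 'a \<Rightarrow> nat" and K :: "nat \<Rightarrow> real"
  assumes renewal: "renewal_process P \<tau> K"
begin

sublocale P: prob_space P
  using renewal by (simp add: renewal_process_def)

definition gaps :: "nat \<Rightarrow> 'a \<Rightarrow> nat list" where
  "gaps k x = map (\<lambda>i. \<tau> (Suc i) x - \<tau> i x) [0..<k]"

lemma tau_0: "x \<in> space P \<Longrightarrow> \<tau> 0 x = 0"
  and strict_mono_tau: "x \<in> space P \<Longrightarrow> strict_mono (\<lambda>k. \<tau> k x)"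
  using renewal by (auto simp: renewal_process_def strict_mono_Suc_iff)

lemma tau_less_Suc: "x \<in> space P \<Longrightarrow> \<tau> k x < \<tau> (Suc k) x"
  using strict_mono_tau by (simp add: strict_mono_Suc_iff)

lemma length_gaps [simp]: "length (gaps k x) = k"
  by (simp add: gaps_def)

lemma sum_list_gaps: "x \<in> space P \<Longrightarrow> sum_list (gaps k x) = \<tau> k x"
proof (induction k)
  case (Suc k)
  then show ?case using tau_less_Suc[of x k] by (simp add: gaps_def)
qed (simp add: gaps_def tau_0)

lemma zero_notin_gaps:
  assumes "x \<in> space P"
  shows "0 \<notin> set (gaps k x)"
proof
  assume "0 \<in> set (gaps k x)"
  then obtain i where "\<tau> (Suc i) x \<le> \<tau> i x" by (auto simp: gaps_def)
  with tau_less_Suc[OF assms, of i] show False by simp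
qed

lemma partial_sums_gaps:
  "x \<in> space P \<Longrightarrow> partial_sums 0 (gaps k x) = map (\<lambda>i. \<tau> (Suc i) x) [0..<k]"
proof (induction k)
  case (Suc k)
  have "gaps (Suc k) x = gaps k x @ [\<tau> (Suc k) x - \<tau> k x]" by (simp add: gaps_def)
  then have "partial_sums 0 (gaps (Suc k) x)
      = partial_sums 0 (gaps k x) @ [\<tau> k x + (\<tau> (Suc k) x - \<tau> k x)]"
    by (simp only: partial_sums_append sum_list_gaps[OF Suc.prems] partial_sums.simps add_0)
  also have "\<tau> k x + (\<tau> (Suc k) x - \<tau> k x) = \<tau> (Suc k) x"
    using tau_less_Suc[OF Suc.prems, of k] by simp
  finally show ?case using Suc by simp
qed (simp add: gaps_def)

lemma gaps_eq_iff:
  "gaps (length l) x = l \<longleftrightarrow> (\<forall>i\<in>{..<length l}. \<tau> (Suc i) x - \<tau> i x = l ! i)"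
proof -
  have "gaps (length l) x = l \<longleftrightarrow> (\<forall>i<length l. gaps (length l) x ! i = l ! i)"
    by (subst list_eq_iff_nth_eq) simp
  also have "\<dots> \<longleftrightarrow> (\<forall>i<length l. \<tau> (Suc i) x - \<tau> i x = l ! i)"
    by (simp add: gaps_def)
  finally show ?thesis by (simp add: Ball_def)
qed

lemma events_gaps: "{x \<in> space P. gaps (length l) x = l} \<in> P.events"
  unfolding gaps_eq_iff
proof (rule sets.sets_Collect_finite_All)
  fix i
  have "(\<lambda>x. \<tau> (Suc i) x - \<tau> i x) \<in> measurable P (count_space UNIV)"
    using renewal by (simp add: renewal_process_def P.indep_vars_def)
  from measurable_sets[OF this, of "{l ! i}"]
  show "{x \<in> space P. \<tau> (Suc i) x - \<tau> i x = l ! i} \<in> P.events"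
    by (simp add: vimage_def Int_def conj_commute)
qed auto

lemma prob_gaps:
  assumes "0 \<notin> set l"
  shows "P.prob {x \<in> space P. gaps (length l) x = l} = prod_list (map K l)"
proof (cases "l = []")
  case True
  then show ?thesis by (simp add: gaps_def P.prob_space)
next
  case False
  let ?I = "{..<length l}" and ?E = "\<lambda>i. {x \<in> space P. \<tau> (Suc i) x - \<tau> i x = l ! i}"
  have "P.indep_vars (\<lambda>_. count_space UNIV) (\<lambda>k x. \<tau> (Suc k) x - \<tau> k x) UNIV"
    using renewal by (simp add: renewal_process_def)
  then have "P.indep_vars (\<lambda>_. count_space UNIV) (\<lambda>k x. \<tau> (Suc k) x - \<tau> k x) ?I"
    by (rule P.indep_vars_subset) simp
  then have indep: "P.indep_events ?E ?I"
    by (rule P.indep_eventsI_indep_vars) simp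
  have "{x \<in> space P. gaps (length l) x = l} = (\<Inter>i\<in>?I. ?E i)"
    using False by (auto simp: gaps_eq_iff)
  also have "P.prob \<dots> = (\<Prod>i\<in>?I. P.prob (?E i))"
    using indep False unfolding P.indep_events_def by blast
  also have "\<dots> = (\<Prod>i\<in>?I. K (l ! i))"
  proof (intro prod.cong refl)
    fix i assume "i \<in> ?I"
    then have "l ! i \<ge> 1" using assms nth_mem[of i l] by (cases "l ! i") auto
    then show "P.prob (?E i) = K (l ! i)"
      using renewal by (simp add: renewal_process_def)
  qed
  finally show ?thesis
    by (simp add: prod.list_conv_set_nth lessThan_atLeast0)
qed

lemma K_nonneg:
  assumes "n \<ge> 1"
  shows "K n \<ge> 0"
proof -
  have "P.prob {x \<in> space P. \<tau> (Suc 0) x - \<tau> 0 x = n} = K n"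
    using renewal assms unfolding renewal_process_def by blast
  then show ?thesis by (metis measure_nonneg)
qed

text \<open>If the renewal visits \<open>n\<close> at its \<open>k\<close>-th step, the only composition matching the trajectory is
  the list of its first \<open>k\<close> gaps; otherwise no composition matches.\<close>

lemma boltzmann_weight_eq_sum_compositions:
  assumes x: "x \<in> space P"
  shows "exp (hamiltonian \<tau> n \<beta> h w x) * renewal_delta \<tau> n x =
    (\<Sum>l\<in>compositions n. indicator {x \<in> space P. gaps (length l) x = l} x
        * exp (\<Sum>j\<leftarrow>partial_sums 0 l. \<beta> * w (int j) + h))"
proof (cases "n \<in> range (\<lambda>k. \<tau> k x)")
  case False
  have "indicator {x \<in> space P. gaps (length l) x = l} x = (0::real)" if "l \<in> compositions n" for l
    using that False sum_list_gaps[OF x, of "length l"] by (auto simp: indicator_def compositions_def)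
  then show ?thesis using False by (simp add: renewal_delta_def)
next
  case True
  then obtain k where k: "n = \<tau> k x" by blast
  let ?l = "gaps k x"
  have tau_eq: "\<tau> i x = \<tau> j x \<longleftrightarrow> i = j" for i j
    using strict_mono_eq[OF strict_mono_tau[OF x]] by blast
  have unique: "gaps (length l) x \<noteq> l" if "l \<in> compositions n" "l \<noteq> ?l" for l
  proof
    assume eq: "gaps (length l) x = l"
    then have "\<tau> (length l) x = \<tau> k x"
      using that(1) sum_list_gaps[OF x, of "length l"] by (simp add: compositions_def k)
    then show False using eq that(2) by (simp add: tau_eq)
  qed
  have l: "?l \<in> compositions n"
    using sum_list_gaps[OF x] zero_notin_gaps[OF x] by (simp add: compositions_def k)
  have "(\<Sum>l\<in>compositions n. indicator {x \<in> space P. gaps (length l) x = l} x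
        * exp (\<Sum>j\<leftarrow>partial_sums 0 l. \<beta> * w (int j) + h))
    = (\<Sum>l\<in>{?l}. indicator {x \<in> space P. gaps (length l) x = l} x
        * exp (\<Sum>j\<leftarrow>partial_sums 0 l. \<beta> * w (int j) + h))"
  proof (rule sum.mono_neutral_right)
    show "\<forall>l\<in>compositions n - {?l}. indicator {x \<in> space P. gaps (length l) x = l} x
        * exp (\<Sum>j\<leftarrow>partial_sums 0 l. \<beta> * w (int j) + h) = 0"
      using unique by (simp add: indicator_def)
  qed (use l finite_compositions in auto)
  also have "\<dots> = exp (\<Sum>j\<leftarrow>partial_sums 0 ?l. \<beta> * w (int j) + h)"
    using x by simp
  also have "(\<Sum>j\<leftarrow>partial_sums 0 ?l. \<beta> * w (int j) + h)
      = (\<Sum>i<k. \<beta> * w (int (\<tau> (Suc i) x)) + h)"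
    by (simp add: partial_sums_gaps[OF x] interv_sum_list_conv_sum_set_nat lessThan_atLeast0 comp_def)
  also have "\<dots> = (\<Sum>j\<in>(\<lambda>i. \<tau> (Suc i) x) ` {..<k}. \<beta> * w (int j) + h)"
    by (subst sum.reindex) (auto simp: inj_on_def tau_eq)
  also have "\<dots> = (\<Sum>j=1..n. (\<beta> * w (int j) + h) * renewal_delta \<tau> j x)"
  proof (rule sum.mono_neutral_cong_left)
    have "1 \<le> \<tau> (Suc i) x \<and> \<tau> (Suc i) x \<le> n" if "i < k" for i
      using tau_less_Suc[OF x, of i] strict_mono_less_eq[OF strict_mono_tau[OF x], of "Suc i" k] that
      by (simp add: k)
    then show "(\<lambda>i. \<tau> (Suc i) x) ` {..<k} \<subseteq> {1..n}" by auto
    show "\<forall>j\<in>{1..n} - (\<lambda>i. \<tau> (Suc i) x) ` {..<k}. (\<beta> * w (int j) + h) * renewal_delta \<tau> j x = 0"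
    proof
      fix j assume j: "j \<in> {1..n} - (\<lambda>i. \<tau> (Suc i) x) ` {..<k}"
      have "j \<noteq> \<tau> i x" for i
      proof
        assume i: "j = \<tau> i x"
        with j have "i \<noteq> 0" by (auto simp: tau_0[OF x])
        then obtain i' where i': "i = Suc i'" by (cases i) auto
        have "i \<le> k"
          using j i strict_mono_less_eq[OF strict_mono_tau[OF x], of i k] by (simp add: k)
        with j show False by (auto simp: i i')
      qed
      then show "(\<beta> * w (int j) + h) * renewal_delta \<tau> j x = 0" by (auto simp: renewal_delta_def)
    qed
  qed (auto simp: renewal_delta_def)
  finally show ?thesis using True by (simp add: hamiltonian_def renewal_delta_def)
qed

lemma quenched_Z_eq_sum_compositions:
  "quenched_Z P \<tau> n \<beta> h w =
    (\<Sum>l\<in>compositions n. prod_list (map K l) * exp (\<Sum>j\<leftarrow>partial_sums 0 l. \<beta> * w (int j) + h))"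
proof -
  have "quenched_Z P \<tau> n \<beta> h w =
    (\<integral>x. (\<Sum>l\<in>compositions n. indicator {x \<in> space P. gaps (length l) x = l} x
        * exp (\<Sum>j\<leftarrow>partial_sums 0 l. \<beta> * w (int j) + h)) \<partial>P)"
    unfolding quenched_Z_def
    by (rule Bochner_Integration.integral_cong[OF refl boltzmann_weight_eq_sum_compositions])
  also have "\<dots> = (\<Sum>l\<in>compositions n. \<integral>x. indicator {x \<in> space P. gaps (length l) x = l} x
        * exp (\<Sum>j\<leftarrow>partial_sums 0 l. \<beta> * w (int j) + h) \<partial>P)"
    by (rule Bochner_Integration.integral_sum)
      (rule integrable_mult_left, rule integrable_real_indicator, rule events_gaps, simp add: P.emeasure_eq_measure)
  also have "\<dots> = (\<Sum>l\<in>compositions n. prod_list (map K l) * exp (\<Sum>j\<leftarrow>partial_sums 0 l. \<beta> * w (int j) + h))"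
  proof (rule sum.cong[OF refl])
    fix l assume "l \<in> compositions n"
    then have "P.prob {x \<in> space P. gaps (length l) x = l} = prod_list (map K l)"
      by (intro prob_gaps) (simp add: compositions_def)
    moreover have "{x \<in> space P. gaps (length l) x = l} \<inter> space P = {x \<in> space P. gaps (length l) x = l}"
      by blast
    ultimately show "(\<integral>x. indicator {x \<in> space P. gaps (length l) x = l} x
        * exp (\<Sum>j\<leftarrow>partial_sums 0 l. \<beta> * w (int j) + h) \<partial>P)
      = prod_list (map K l) * exp (\<Sum>j\<leftarrow>partial_sums 0 l. \<beta> * w (int j) + h)"
      by (simp only: integral_mult_left_zero Bochner_Integration.integral_indicator real_scaleR_def)
  qed
  finally show ?thesis .
qed

end

section \<open>Gaussian disorder with finite range correlations\<close>

text \<open>Completing the square turns the tilted normal density into a multiple of a shifted one.\<close>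

lemma (in prob_space) normal_exp_moment:
  assumes X: "distributed M lborel X (normal_density \<mu> \<sigma>)" and \<sigma>: "\<sigma> > 0"
  shows "integrable M (\<lambda>y. exp (t * X y))"
    and "expectation (\<lambda>y. exp (t * X y)) = exp (t * \<mu> + t\<^sup>2 * \<sigma>\<^sup>2 / 2)"
proof -
  have eq: "normal_density \<mu> \<sigma> x * exp (t * x)
      = exp (t * \<mu> + t\<^sup>2 * \<sigma>\<^sup>2 / 2) * normal_density (\<mu> + t * \<sigma>\<^sup>2) \<sigma> x" for x
  proof -
    have "- (x - \<mu>)\<^sup>2 / (2 * \<sigma>\<^sup>2) + t * x
        = (t * \<mu> + t\<^sup>2 * \<sigma>\<^sup>2 / 2) + - (x - (\<mu> + t * \<sigma>\<^sup>2))\<^sup>2 / (2 * \<sigma>\<^sup>2)"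
      using \<sigma> by (simp add: field_simps power2_eq_square)
    then have "exp (- (x - \<mu>)\<^sup>2 / (2 * \<sigma>\<^sup>2)) * exp (t * x)
        = exp (t * \<mu> + t\<^sup>2 * \<sigma>\<^sup>2 / 2) * exp (- (x - (\<mu> + t * \<sigma>\<^sup>2))\<^sup>2 / (2 * \<sigma>\<^sup>2))"
      by (metis exp_add)
    then show ?thesis by (simp add: normal_density_def)
  qed
  have "integrable lborel (\<lambda>x. normal_density \<mu> \<sigma> x * exp (t * x))"
    unfolding eq using \<sigma> by simp
  then show "integrable M (\<lambda>y. exp (t * X y))"
    by (subst (asm) distributed_integrable[OF X]) auto
  have "(\<integral>x. normal_density \<mu> \<sigma> x * exp (t * x) \<partial>lborel) = expectation (\<lambda>y. exp (t * X y))"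
    by (rule distributed_integral[OF X]) auto
  then show "expectation (\<lambda>y. exp (t * X y)) = exp (t * \<mu> + t\<^sup>2 * \<sigma>\<^sup>2 / 2)"
    unfolding eq using \<sigma> by simp
qed

lemma (in prob_space) gaussian_exp_moment:
  assumes X: "gaussian_rv M X" and mean: "expectation X = 0"
  shows "integrable M (\<lambda>y. exp (t * X y))"
    and "expectation (\<lambda>y. exp (t * X y)) = exp (t\<^sup>2 / 2 * expectation (\<lambda>y. (X y)\<^sup>2))"
proof -
  have [measurable]: "X \<in> borel_measurable M" using X by (simp add: gaussian_rv_def)
  have "integrable M (\<lambda>y. exp (t * X y)) \<and>
    expectation (\<lambda>y. exp (t * X y)) = exp (t\<^sup>2 / 2 * expectation (\<lambda>y. (X y)\<^sup>2))"
    using X unfolding gaussian_rv_def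
  proof (elim conjE exE disjE)
    fix \<mu> assume ae: "AE y in M. X y = \<mu>"
    then have "expectation X = expectation (\<lambda>_. \<mu>)" by (intro integral_cong_AE) auto
    then have "\<mu> = 0" using mean by (simp add: prob_space)
    then have ae: "AE y in M. X y = 0" using ae by simp
    have "expectation (\<lambda>y. (X y)\<^sup>2) = expectation (\<lambda>_. 0)"
      by (rule integral_cong_AE) (use ae in auto)
    moreover have "expectation (\<lambda>y. exp (t * X y)) = expectation (\<lambda>_. 1)"
      by (rule integral_cong_AE) (use ae in auto)
    moreover have "integrable M (\<lambda>y. exp (t * X y))"
      by (subst integrable_cong_AE[where g="\<lambda>_. 1"])
        (use ae in auto)
    ultimately show ?thesis by (simp add: prob_space)
  next
    fix \<mu> \<sigma> :: real assume "\<sigma> > 0" and D: "distributed M lborel X (normal_density \<mu> \<sigma>)"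
    then have "\<mu> = 0" using normal_distributed_expectation mean by metis
    moreover have "variance X = \<sigma>\<^sup>2" using normal_distributed_variance[OF \<open>\<sigma> > 0\<close> D] .
    ultimately show ?thesis
      using normal_exp_moment[OF D \<open>\<sigma> > 0\<close>, of t] mean by (simp add: mult.commute)
  qed
  then show "integrable M (\<lambda>y. exp (t * X y))"
    and "expectation (\<lambda>y. exp (t * X y)) = exp (t\<^sup>2 / 2 * expectation (\<lambda>y. (X y)\<^sup>2))"
    by auto
qed

lemma abs_mult_le_squares: "\<bar>a * b\<bar> \<le> (a\<^sup>2 + b\<^sup>2) / 2" for a b :: real
proof -
  have "0 \<le> (\<bar>a\<bar> - \<bar>b\<bar>)\<^sup>2" by simp
  then show ?thesis by (simp add: power2_diff abs_mult)
qed

locale gaussian_disorder = prob_space M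
  for M :: "'b measure" +
  fixes \<omega> :: "int \<Rightarrow> 'b \<Rightarrow> real" and q :: nat
  assumes gaussian: "gaussian_process M \<omega>"
    and stationary: "stationary_process M \<omega>"
    and mean: "expectation (\<omega> n) = 0"
    and variance: "variance (\<omega> n) = 1"
    and finite_range: "n > int q \<Longrightarrow> covariance M (\<omega> 0) (\<omega> n) = 0"
begin

definition cov :: "int \<Rightarrow> int \<Rightarrow> real" where
  "cov i j = expectation (\<lambda>y. \<omega> i y * \<omega> j y)"

text \<open>The variance of \<open>\<Sum>i\<in>I. \<omega> i\<close>, expanded into covariances.\<close>

definition disorder_variance :: "int set \<Rightarrow> real" where
  "disorder_variance I = (\<Sum>i\<in>I. \<Sum>j\<in>I. cov i j)"

lemma measurable_omega [measurable]: "\<omega> n \<in> borel_measurable M"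
  using gaussian by (simp add: gaussian_process_def)

lemma expectation_square: "expectation (\<lambda>y. (\<omega> n y)\<^sup>2) = 1"
  using variance[of n] mean[of n] by simp

lemma integrable_square: "integrable M (\<lambda>y. (\<omega> n y)\<^sup>2)"
  using expectation_square[of n] not_integrable_integral_eq by fastforce

lemma integrable_mult_omega: "integrable M (\<lambda>y. \<omega> i y * \<omega> j y)"
proof (rule Bochner_Integration.integrable_bound)
  show "integrable M (\<lambda>y. (\<omega> i y)\<^sup>2 + (\<omega> j y)\<^sup>2)"
    by (intro Bochner_Integration.integrable_add integrable_square)
  show "AE y in M. norm (\<omega> i y * \<omega> j y) \<le> norm ((\<omega> i y)\<^sup>2 + (\<omega> j y)\<^sup>2)"
  proof (rule AE_I2)
    fix y
    have "norm (\<omega> i y * \<omega> j y) \<le> ((\<omega> i y)\<^sup>2 + (\<omega> j y)\<^sup>2) / 2"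
      using abs_mult_le_squares[of "\<omega> i y" "\<omega> j y"] unfolding real_norm_def .
    also have "\<dots> \<le> (\<omega> i y)\<^sup>2 + (\<omega> j y)\<^sup>2" by (simp add: field_simps)
    also have "\<dots> \<le> norm ((\<omega> i y)\<^sup>2 + (\<omega> j y)\<^sup>2)" unfolding real_norm_def by (rule abs_ge_self)
    finally show "norm (\<omega> i y * \<omega> j y) \<le> norm ((\<omega> i y)\<^sup>2 + (\<omega> j y)\<^sup>2)" .
  qed
qed measurable

lemma integrable_omega: "integrable M (\<omega> n)"
  by (rule square_integrable_imp_integrable[OF measurable_omega integrable_square])

lemma cov_le_1: "cov i j \<le> 1"
proof -
  have "cov i j \<le> expectation (\<lambda>y. ((\<omega> i y)\<^sup>2 + (\<omega> j y)\<^sup>2) / 2)"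
    unfolding cov_def
  proof (rule integral_mono[OF integrable_mult_omega])
    show "integrable M (\<lambda>y. ((\<omega> i y)\<^sup>2 + (\<omega> j y)\<^sup>2) / 2)"
      using integrable_square by auto
    show "\<omega> i y * \<omega> j y \<le> ((\<omega> i y)\<^sup>2 + (\<omega> j y)\<^sup>2) / 2" for y
      using abs_mult_le_squares[of "\<omega> i y" "\<omega> j y"] by linarith
  qed
  also have "\<dots> = 1" using integrable_square expectation_square by simp
  finally show ?thesis .
qed

lemma cov_self: "cov i i = 1"
  using expectation_square[of i] by (simp add: cov_def power2_eq_square)

lemma cov_commute: "cov i j = cov j i"
  by (simp add: cov_def mult.commute)

lemma cov_shift: "cov (i + m) (j + m) = cov i j"
proof -
  let ?N = "PiM UNIV (\<lambda>_. borel) :: (int \<Rightarrow> real) measure"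
  have m: "(\<lambda>y n. \<omega> (n + k) y) \<in> measurable M ?N" for k
    by (rule measurable_PiM_single') auto
  have f: "(\<lambda>x. x i * x j) \<in> borel_measurable ?N"
    by (intro borel_measurable_times measurable_component_singleton) auto
  have "cov (i + m) (j + m) = (\<integral>x. x i * x j \<partial>distr M ?N (\<lambda>y n. \<omega> (n + m) y))"
    unfolding integral_distr[OF m f] cov_def ..
  also have "\<dots> = (\<integral>x. x i * x j \<partial>distr M ?N (\<lambda>y n. \<omega> n y))"
    using stationary by (simp add: stationary_process_def)
  also have "\<dots> = cov i j"
    using integral_distr[OF m[of 0] f] by (simp add: cov_def)
  finally show ?thesis .
qed

lemma cov_eq_0: assumes "\<bar>i - j\<bar> > int q" shows "cov i j = 0"
proof -
  have *: "cov i j = 0" if "j - i > int q" for i j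
  proof -
    have "cov i j = cov 0 (j - i)" using cov_shift[of 0 i "j - i"] by simp
    also have "\<dots> = covariance M (\<omega> 0) (\<omega> (j - i))" by (simp add: covariance_def cov_def mean)
    finally show ?thesis using finite_range[OF that] by simp
  qed
  show ?thesis
    using assms *[of i j] *[of j i] cov_commute[of i j] by linarith
qed

text \<open>Each site is correlated with at most \<open>2 q + 1\<close> sites, itself included.\<close>

lemma disorder_variance_le:
  assumes "finite I"
  shows "disorder_variance I \<le> (2 * real q + 1) * real (card I)"
proof -
  have "(\<Sum>j\<in>I. cov i j) \<le> 2 * real q + 1" for i
  proof -
    have "(\<Sum>j\<in>I. cov i j) \<le> (\<Sum>j\<in>I. if j \<in> {i - int q..i + int q} then 1 else 0)"
    proof (rule sum_mono)
      fix j
      have "cov i j = 0" if "j \<notin> {i - int q..i + int q}"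
        using that by (intro cov_eq_0) (simp, linarith)
      then show "cov i j \<le> (if j \<in> {i - int q..i + int q} then 1 else 0)"
        using cov_le_1[of i j] by (cases "j \<in> {i - int q..i + int q}") auto
    qed
    also have "\<dots> = real (card (I \<inter> {i - int q..i + int q}))"
      using assms by (simp add: sum.If_cases Int_def)
    also have "\<dots> \<le> real (card {i - int q..i + int q})"
      by (intro of_nat_mono card_mono) auto
    finally show ?thesis by simp
  qed
  then have "disorder_variance I \<le> (\<Sum>i\<in>I. 2 * real q + 1)"
    unfolding disorder_variance_def by (intro sum_mono)
  then show ?thesis by (simp add: mult.commute)
qed

lemma disorder_variance_shift: "disorder_variance ((+) m ` I) = disorder_variance I"
  by (simp add: disorder_variance_def sum.reindex cov_shift[of _ m, unfolded add.commute[of _ m]])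

lemma disorder_variance_Un:
  assumes "finite A" "finite B" and far: "\<And>a b. a \<in> A \<Longrightarrow> b \<in> B \<Longrightarrow> \<bar>a - b\<bar> > int q"
  shows "disorder_variance (A \<union> B) = disorder_variance A + disorder_variance B"
proof -
  have disj: "A \<inter> B = {}" using far[of x x for x] by fastforce
  have AB: "(\<Sum>i\<in>A. \<Sum>j\<in>B. cov i j) = 0"
    by (intro sum.neutral ballI cov_eq_0 far)
  have BA: "(\<Sum>i\<in>B. \<Sum>j\<in>A. cov i j) = 0"
    by (subst cov_commute) (intro sum.neutral ballI cov_eq_0 far)
  then show ?thesis
    unfolding disorder_variance_def by (simp add: sum.union_disjoint[OF assms(1,2) disj] sum.distrib AB BA)
qed

lemma exp_moment_sum:
  assumes "finite I"
  shows "integrable M (\<lambda>y. exp (t * (\<Sum>i\<in>I. \<omega> i y)))"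
    and "expectation (\<lambda>y. exp (t * (\<Sum>i\<in>I. \<omega> i y))) = exp (t\<^sup>2 / 2 * disorder_variance I)"
proof -
  have "gaussian_rv M (\<lambda>y. \<Sum>i\<in>I. 1 * \<omega> i y)"
    using gaussian[unfolded gaussian_process_def, THEN conjunct2, rule_format, of I "\<lambda>_. 1"] assms .
  then have g: "gaussian_rv M (\<lambda>y. \<Sum>i\<in>I. \<omega> i y)" by simp
  have e: "expectation (\<lambda>y. \<Sum>i\<in>I. \<omega> i y) = 0"
    by (subst Bochner_Integration.integral_sum) (auto simp: integrable_omega mean)
  have "expectation (\<lambda>y. (\<Sum>i\<in>I. \<omega> i y)\<^sup>2)
      = expectation (\<lambda>y. \<Sum>i\<in>I. \<Sum>j\<in>I. \<omega> i y * \<omega> j y)"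
    by (simp only: power2_eq_square sum_product)
  also have "\<dots> = (\<Sum>i\<in>I. expectation (\<lambda>y. \<Sum>j\<in>I. \<omega> i y * \<omega> j y))"
    by (intro Bochner_Integration.integral_sum Bochner_Integration.integrable_sum integrable_mult_omega)
  also have "\<dots> = (\<Sum>i\<in>I. \<Sum>j\<in>I. expectation (\<lambda>y. \<omega> i y * \<omega> j y))"
    by (intro sum.cong refl Bochner_Integration.integral_sum integrable_mult_omega)
  also have "\<dots> = disorder_variance I"
    unfolding disorder_variance_def cov_def ..
  finally have v: "expectation (\<lambda>y. (\<Sum>i\<in>I. \<omega> i y)\<^sup>2) = disorder_variance I" .
  show "integrable M (\<lambda>y. exp (t * (\<Sum>i\<in>I. \<omega> i y)))"
    by (rule gaussian_exp_moment(1)[OF g e])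
  show "expectation (\<lambda>y. exp (t * (\<Sum>i\<in>I. \<omega> i y))) = exp (t\<^sup>2 / 2 * disorder_variance I)"
    using gaussian_exp_moment(2)[OF g e, of t] unfolding v .
qed

definition trajectory_variance :: "nat list \<Rightarrow> real" where
  "trajectory_variance l = disorder_variance (int ` set (partial_sums 0 l))"

lemma disorder_variance_partial_sums: "disorder_variance (int ` set (partial_sums a l)) = trajectory_variance l"
proof -
  have "int ` set (partial_sums (a + 0) l) = (+) (int a) ` int ` set (partial_sums 0 l)"
    unfolding partial_sums_shift by (auto simp: image_image)
  then show ?thesis by (simp add: disorder_variance_shift trajectory_variance_def)
qed

lemma trajectory_variance_le:
  "trajectory_variance l \<le> (2 * real q + 1) * real (length l)"
proof -
  have "trajectory_variance l \<le> (2 * real q + 1) * real (card (int ` set (partial_sums 0 l)))"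
    unfolding trajectory_variance_def by (rule disorder_variance_le) simp
  also have "\<dots> \<le> (2 * real q + 1) * real (length l)"
    using card_length[of "partial_sums 0 l"]
    by (intro mult_left_mono) (auto simp: card_image)
  finally show ?thesis .
qed

lemma exp_moment_trajectory:
  assumes "0 \<notin> set l"
  shows "integrable M (\<lambda>y. exp (\<Sum>j\<leftarrow>partial_sums 0 l. \<beta> * \<omega> (int j) y + h))"
    and "expectation (\<lambda>y. exp (\<Sum>j\<leftarrow>partial_sums 0 l. \<beta> * \<omega> (int j) y + h))
      = exp (\<beta>\<^sup>2 / 2 * trajectory_variance l + h * real (length l))"
proof -
  let ?I = "int ` set (partial_sums 0 l)"
  have d: "distinct (partial_sums 0 l)" using distinct_partial_sums[OF assms] .
  have eq: "(\<Sum>j\<leftarrow>partial_sums 0 l. \<beta> * \<omega> (int j) y + h)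
      = \<beta> * (\<Sum>i\<in>?I. \<omega> i y) + h * real (length l)" for y
  proof -
    have "(\<Sum>j\<leftarrow>partial_sums 0 l. \<beta> * \<omega> (int j) y + h)
      = (\<Sum>j\<in>set (partial_sums 0 l). \<beta> * \<omega> (int j) y + h)"
      using d by (rule sum_list_distinct_conv_sum_set)
    also have "\<dots> = \<beta> * (\<Sum>i\<in>?I. \<omega> i y) + h * real (length l)"
      using distinct_card[OF d] by (simp add: sum.distrib sum_distrib_left sum.reindex mult.commute)
    finally show ?thesis .
  qed
  have fin: "finite ?I" by simp
  show "integrable M (\<lambda>y. exp (\<Sum>j\<leftarrow>partial_sums 0 l. \<beta> * \<omega> (int j) y + h))"
    and "expectation (\<lambda>y. exp (\<Sum>j\<leftarrow>partial_sums 0 l. \<beta> * \<omega> (int j) y + h))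
      = exp (\<beta>\<^sup>2 / 2 * trajectory_variance l + h * real (length l))"
    unfolding eq exp_add trajectory_variance_def
    using exp_moment_sum[OF fin, of \<beta>] by simp_all
qed

text \<open>When the first gap of the second piece exceeds the correlation range, the disorder seen by the
  two pieces is uncorrelated.\<close>

lemma trajectory_variance_append:
  assumes "0 \<notin> set l" "0 \<notin> set l'" "l' \<noteq> []" "hd l' > q"
  shows "trajectory_variance (l @ l') = trajectory_variance l + trajectory_variance l'"
proof -
  let ?A = "int ` set (partial_sums 0 l)" and ?B = "int ` set (partial_sums (sum_list l) l')"
  obtain m l'' where l': "l' = m # l''" using assms(3) by (cases l') auto
  have b: "sum_list l + m \<le> b" if b: "b \<in> set (partial_sums (sum_list l) l')" for b
  proof -
    have "0 \<notin> set l''" using assms(2) by (simp add: l')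
    from partial_sums_bounds[OF this, of b "sum_list l + m"] b show ?thesis
      by (auto simp: l')
  qed
  have "disorder_variance (?A \<union> ?B) = disorder_variance ?A + disorder_variance ?B"
  proof (rule disorder_variance_Un)
    fix a b assume "a \<in> ?A" "b \<in> ?B"
    then obtain a' b' where ab: "a = int a'" "b = int b'"
      "a' \<in> set (partial_sums 0 l)" "b' \<in> set (partial_sums (sum_list l) l')" by blast
    have "a' \<le> sum_list l" using partial_sums_bounds[OF assms(1) ab(3)] by simp
    moreover have "sum_list l + q < b'" using b[OF ab(4)] assms(4) by (simp add: l')
    ultimately show "\<bar>a - b\<bar> > int q" by (simp add: ab)
  qed auto
  moreover have "int ` set (partial_sums 0 (l @ l')) = ?A \<union> ?B"
    by (simp add: partial_sums_append image_Un)
  ultimately have "trajectory_variance (l @ l') = disorder_variance ?A + disorder_variance ?B"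
    unfolding trajectory_variance_def by (simp only:)
  then show ?thesis by (simp only: disorder_variance_partial_sums)
qed

text \<open>Stationarity allows the first gap to be lengthened at no cost; this is how an arbitrary block is
  made repeatable.\<close>

lemma trajectory_variance_delay:
  "trajectory_variance ((m + k) # l) = trajectory_variance (m # l)"
proof -
  have "partial_sums 0 ((m + k) # l) = partial_sums k (m # l)" by (simp add: add.commute)
  then show ?thesis
    using disorder_variance_partial_sums[of k "m # l"] unfolding trajectory_variance_def by (simp only:)
qed

end

section \<open>Partition functions and fractional moments\<close>

text \<open>After division by the total, every term lies in \<open>{0..1}\<close>, where the power \<open>\<gamma> \<le> 1\<close> only increases
  it.\<close>

lemma powr_sum_le:
  fixes a :: "'i \<Rightarrow> real"
  assumes "finite A" and nonneg: "\<And>i. i \<in> A \<Longrightarrow> a i \<ge> 0" and \<gamma>: "0 < \<gamma>" "\<gamma> \<le> 1"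
  shows "(\<Sum>i\<in>A. a i) powr \<gamma> \<le> (\<Sum>i\<in>A. a i powr \<gamma>)"
proof (cases "(\<Sum>i\<in>A. a i) = 0")
  case True
  then show ?thesis by (simp add: sum_nonneg)
next
  case False
  define s where "s = (\<Sum>i\<in>A. a i)"
  have s: "s > 0" using False sum_nonneg[of A a] nonneg by (simp add: s_def less_le)
  have "a i / s \<le> a i powr \<gamma> / s powr \<gamma>" if i: "i \<in> A" for i
  proof -
    have "a i \<le> s" unfolding s_def using assms(1) nonneg i by (intro member_le_sum) auto
    then have "0 \<le> a i / s" "a i / s \<le> 1" using s nonneg[OF i] by auto
    then have "(a i / s) powr 1 \<le> (a i / s) powr \<gamma>"
      using \<gamma> by (intro powr_mono') auto
    then show ?thesis using nonneg[OF i] s by (simp add: powr_divide)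
  qed
  then have "(\<Sum>i\<in>A. a i / s) \<le> (\<Sum>i\<in>A. a i powr \<gamma> / s powr \<gamma>)" by (rule sum_mono)
  then have "1 \<le> (\<Sum>i\<in>A. a i powr \<gamma>) / s powr \<gamma>"
    using s by (simp add: sum_divide_distrib[symmetric] s_def[symmetric])
  then show ?thesis using s by (simp add: s_def[symmetric] le_divide_eq)
qed

lemma prod_list_powr:
  fixes K :: "nat \<Rightarrow> real"
  assumes "\<And>m. m \<in> set l \<Longrightarrow> K m \<ge> 0"
  shows "prod_list (map K l) powr \<gamma> = prod_list (map (\<lambda>m. K m powr \<gamma>) l)"
  using assms
proof (induction l)
  case (Cons m l)
  have "prod_list (map K l) \<ge> 0" using Cons.prems by (intro prod_list_nonneg) auto
  then show ?case using Cons by (simp add: powr_mult)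
qed simp

lemma prod_list_map_mult_const:
  fixes g :: "'i \<Rightarrow> real"
  shows "prod_list (map (\<lambda>m. g m * c) l) = prod_list (map g l) * c ^ length l"
  by (induction l) auto

locale pinning_model = renewal P \<tau> K + gaussian_disorder M \<omega> q
  for P :: "'a measure" and \<tau> :: "nat \<Rightarrow> 'a \<Rightarrow> nat" and K :: "nat \<Rightarrow> real"
    and M :: "'b measure" and \<omega> :: "int \<Rightarrow> 'b \<Rightarrow> real" and q :: nat +
  assumes K_pos: "n \<ge> 1 \<Longrightarrow> K n > 0"
    and K_log: "(\<lambda>n. ln (K n) / real n) \<longlonglongrightarrow> 0"
    and K_sum: "(\<lambda>n. K (Suc n)) sums 1"
begin

abbreviation Z :: "nat \<Rightarrow> real \<Rightarrow> real \<Rightarrow> 'b \<Rightarrow> real" where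
  "Z n \<beta> h y \<equiv> quenched_Z P \<tau> n \<beta> h (\<lambda>k. \<omega> k y)"

lemma prod_K_pos: "0 \<notin> set l \<Longrightarrow> prod_list (map K l) > 0"
proof (induction l)
  case (Cons m l)
  then show ?case using K_pos[of m] by (cases m) auto
qed simp

lemma quenched_Z_ge:
  assumes "l \<in> compositions n"
  shows "prod_list (map K l) * exp (\<Sum>j\<leftarrow>partial_sums 0 l. \<beta> * w (int j) + h)
    \<le> quenched_Z P \<tau> n \<beta> h w"
  unfolding quenched_Z_eq_sum_compositions
  by (rule member_le_sum[OF assms _ finite_compositions])
    (auto simp: compositions_def intro!: mult_nonneg_nonneg less_imp_le[OF prod_K_pos])

lemma quenched_Z_pos: "n \<ge> 1 \<Longrightarrow> quenched_Z P \<tau> n \<beta> h w > 0"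
proof -
  assume n: "n \<ge> 1"
  then have "[n] \<in> compositions n" by (simp add: compositions_def)
  from quenched_Z_ge[OF this, of \<beta> w h] K_pos[OF n] show ?thesis
    by (auto intro: less_le_trans[OF mult_pos_pos[OF K_pos[OF n] exp_gt_zero]])
qed

lemma annealed_Z_eq:
  "annealed_Z P \<tau> M \<omega> n \<beta> h = (\<Sum>l\<in>compositions n. prod_list (map K l)
      * exp (\<beta>\<^sup>2 / 2 * trajectory_variance l + h * real (length l)))"
  unfolding annealed_Z_def quenched_Z_eq_sum_compositions
proof (subst Bochner_Integration.integral_sum)
  fix l assume "l \<in> compositions n"
  then have "0 \<notin> set l" by (simp add: compositions_def)
  then show "integrable M (\<lambda>y. prod_list (map K l) * exp (\<Sum>j\<leftarrow>partial_sums 0 l. \<beta> * \<omega> (int j) y + h))"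
    by (intro integrable_mult_right exp_moment_trajectory)
qed (rule sum.cong[OF refl], simp add: compositions_def exp_moment_trajectory)

text \<open>Bounding every trajectory variance by \<open>v\<close> per visited point makes the weight of a trajectory
  multiplicative over its gaps, so that the sum is dominated by a renewal function.\<close>

lemma sum_K_powr_compositions_le_1:
  assumes density: "\<And>l. 0 \<notin> set l \<Longrightarrow> trajectory_variance l \<le> v * real (length l)"
    and g: "\<And>n. (\<Sum>m=1..n. K m powr \<gamma> * exp ((\<gamma> * \<beta>)\<^sup>2 / 2 * v + \<gamma> * h)) \<le> 1"
  shows "(\<Sum>l\<in>compositions n. prod_list (map K l) powr \<gamma>
      * exp ((\<gamma> * \<beta>)\<^sup>2 / 2 * trajectory_variance l + \<gamma> * h * real (length l))) \<le> 1"
proof -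
  let ?c = "exp ((\<gamma> * \<beta>)\<^sup>2 / 2 * v + \<gamma> * h)"
  have "(\<Sum>l\<in>compositions n. prod_list (map K l) powr \<gamma>
      * exp ((\<gamma> * \<beta>)\<^sup>2 / 2 * trajectory_variance l + \<gamma> * h * real (length l)))
    \<le> (\<Sum>l\<in>compositions n. prod_list (map (\<lambda>m. K m powr \<gamma> * ?c) l))"
  proof (rule sum_mono)
    fix l assume "l \<in> compositions n"
    then have l: "0 \<notin> set l" by (simp add: compositions_def)
    have nonneg: "K m \<ge> 0" if "m \<in> set l" for m
      using that l by (intro K_nonneg) (cases m, auto)
    have "(\<gamma> * \<beta>)\<^sup>2 / 2 * trajectory_variance l \<le> (\<gamma> * \<beta>)\<^sup>2 / 2 * (v * real (length l))"
      by (intro mult_left_mono density l) auto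
    then have "exp ((\<gamma> * \<beta>)\<^sup>2 / 2 * trajectory_variance l + \<gamma> * h * real (length l))
        \<le> exp (real (length l) * ((\<gamma> * \<beta>)\<^sup>2 / 2 * v + \<gamma> * h))"
      by (simp add: algebra_simps)
    also have "\<dots> = ?c ^ length l" by (rule exp_of_nat_mult)
    finally have e: "exp ((\<gamma> * \<beta>)\<^sup>2 / 2 * trajectory_variance l + \<gamma> * h * real (length l))
        \<le> ?c ^ length l" .
    have "prod_list (map K l) powr \<gamma> = prod_list (map (\<lambda>m. K m powr \<gamma>) l)"
      by (rule prod_list_powr) (rule nonneg)
    then have "prod_list (map (\<lambda>m. K m powr \<gamma> * ?c) l)
        = prod_list (map K l) powr \<gamma> * ?c ^ length l"
      by (simp only: prod_list_map_mult_const)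
    then show "prod_list (map K l) powr \<gamma>
        * exp ((\<gamma> * \<beta>)\<^sup>2 / 2 * trajectory_variance l + \<gamma> * h * real (length l))
      \<le> prod_list (map (\<lambda>m. K m powr \<gamma> * ?c) l)"
      using mult_left_mono[OF e powr_ge_zero] by (simp only:)
  qed
  also have "\<dots> \<le> 1"
    by (rule sum_compositions_le_1[OF _ g]) simp
  finally show ?thesis .
qed

text \<open>The power \<open>\<gamma>\<close> moves inside the sum over trajectories by subadditivity. The Gaussian
  expectation then only costs \<open>\<gamma>\<^sup>2 \<beta>\<^sup>2 / 2\<close> per unit of variance, against \<open>\<gamma> \<beta>\<^sup>2 / 2\<close> for the
  \<open>\<gamma>\<close>-th power of the annealed weight.\<close>

lemma fractional_moment_le_1:
  assumes \<gamma>: "0 < \<gamma>" "\<gamma> \<le> 1"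
    and density: "\<And>l. 0 \<notin> set l \<Longrightarrow> trajectory_variance l \<le> v * real (length l)"
    and g: "\<And>n. (\<Sum>m=1..n. K m powr \<gamma> * exp ((\<gamma> * \<beta>)\<^sup>2 / 2 * v + \<gamma> * h)) \<le> 1"
  shows "integrable M (\<lambda>y. Z n \<beta> h y powr \<gamma>)" and "expectation (\<lambda>y. Z n \<beta> h y powr \<gamma>) \<le> 1"
proof -
  let ?S = "\<lambda>l y. \<Sum>j\<leftarrow>partial_sums 0 l. \<gamma> * \<beta> * \<omega> (int j) y + \<gamma> * h"
  let ?B = "\<lambda>y. \<Sum>l\<in>compositions n. prod_list (map K l) powr \<gamma> * exp (?S l y)"
  have le: "Z n \<beta> h y powr \<gamma> \<le> ?B y" for y
  proof -
    have "Z n \<beta> h y powr \<gamma> \<le> (\<Sum>l\<in>compositions n.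
        (prod_list (map K l) * exp (\<Sum>j\<leftarrow>partial_sums 0 l. \<beta> * \<omega> (int j) y + h)) powr \<gamma>)"
      unfolding quenched_Z_eq_sum_compositions
      by (intro powr_sum_le finite_compositions \<gamma>)
        (auto simp: compositions_def intro!: mult_nonneg_nonneg less_imp_le[OF prod_K_pos])
    also have "\<dots> = ?B y"
    proof (rule sum.cong[OF refl])
      fix l assume "l \<in> compositions n"
      then have pos: "prod_list (map K l) > 0" by (intro prod_K_pos) (simp add: compositions_def)
      have "\<gamma> * (\<Sum>j\<leftarrow>partial_sums 0 l. \<beta> * \<omega> (int j) y + h) = ?S l y"
        by (simp add: sum_list_const_mult[symmetric] algebra_simps)
      then show "(prod_list (map K l) * exp (\<Sum>j\<leftarrow>partial_sums 0 l. \<beta> * \<omega> (int j) y + h)) powr \<gamma>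
          = prod_list (map K l) powr \<gamma> * exp (?S l y)"
        using pos by (simp add: powr_mult exp_powr_real mult.commute)
    qed
    finally show ?thesis .
  qed
  have weight_integrable: "integrable M (\<lambda>y. prod_list (map K l) powr \<gamma> * exp (?S l y))"
    if "l \<in> compositions n" for l
    using that by (intro integrable_mult_right exp_moment_trajectory) (simp add: compositions_def)
  have B: "integrable M ?B"
    by (rule Bochner_Integration.integrable_sum) (rule weight_integrable)
  have meas: "(\<lambda>y. \<Sum>j\<leftarrow>ps. \<beta> * \<omega> (int j) y + h) \<in> borel_measurable M" for ps :: "nat list"
    by (induction ps) auto
  have meas_Z: "(\<lambda>y. Z n \<beta> h y powr \<gamma>) \<in> borel_measurable M"
    unfolding quenched_Z_eq_sum_compositions using meas by measurable
  show int: "integrable M (\<lambda>y. Z n \<beta> h y powr \<gamma>)"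
  proof (rule Bochner_Integration.integrable_bound[OF B meas_Z])
    show "AE y in M. norm (Z n \<beta> h y powr \<gamma>) \<le> norm (?B y)"
    proof (rule AE_I2)
      fix y
      have "norm (Z n \<beta> h y powr \<gamma>) = Z n \<beta> h y powr \<gamma>" by simp
      also have "\<dots> \<le> norm (?B y)" by (rule order_trans[OF le]) simp
      finally show "norm (Z n \<beta> h y powr \<gamma>) \<le> norm (?B y)" .
    qed
  qed
  have "expectation (\<lambda>y. Z n \<beta> h y powr \<gamma>) \<le> expectation ?B"
    by (rule integral_mono[OF int B le])
  also have "\<dots> = (\<Sum>l\<in>compositions n. expectation (\<lambda>y. prod_list (map K l) powr \<gamma> * exp (?S l y)))"
    by (rule Bochner_Integration.integral_sum) (rule weight_integrable)
  also have "\<dots> = (\<Sum>l\<in>compositions n. prod_list (map K l) powr \<gamma>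
      * exp ((\<gamma> * \<beta>)\<^sup>2 / 2 * trajectory_variance l + \<gamma> * h * real (length l)))"
  proof (rule sum.cong[OF refl])
    fix l assume "l \<in> compositions n"
    then have "0 \<notin> set l" by (simp add: compositions_def)
    from exp_moment_trajectory(2)[OF this, of "\<gamma> * \<beta>" "\<gamma> * h"]
    show "expectation (\<lambda>y. prod_list (map K l) powr \<gamma> * exp (?S l y)) = prod_list (map K l) powr \<gamma>
      * exp ((\<gamma> * \<beta>)\<^sup>2 / 2 * trajectory_variance l + \<gamma> * h * real (length l))"
      by (subst integral_mult_right_zero) (simp only:)
  qed
  also have "\<dots> \<le> 1" by (rule sum_K_powr_compositions_le_1[OF density g])
  finally show "expectation (\<lambda>y. Z n \<beta> h y powr \<gamma>) \<le> 1" .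
qed

section \<open>The quenched free energy\<close>

lemma expectation_log_Z_tendsto:
  assumes "is_quenched_free_energy P \<tau> M \<omega> \<beta> h f"
  shows "(\<lambda>n. expectation (\<lambda>y. ln (Z n \<beta> h y)) / real n) \<longlonglongrightarrow> f"
proof -
  have int: "integrable M (\<lambda>y. ln (Z n \<beta> h y) / real n)" if "n \<ge> 1" for n
    using assms that by (simp add: is_quenched_free_energy_def)
  have L1: "(\<lambda>n. \<integral>y. \<bar>ln (Z n \<beta> h y) / real n - f\<bar> \<partial>M) \<longlonglongrightarrow> 0"
    using assms by (simp add: is_quenched_free_energy_def)
  have "(\<lambda>n. expectation (\<lambda>y. ln (Z n \<beta> h y)) / real n - f) \<longlonglongrightarrow> 0"
  proof (rule Lim_null_comparison[OF _ L1])
    show "\<forall>\<^sub>F n in sequentially. norm (expectation (\<lambda>y. ln (Z n \<beta> h y)) / real n - f)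
        \<le> (\<integral>y. \<bar>ln (Z n \<beta> h y) / real n - f\<bar> \<partial>M)"
      using eventually_ge_at_top[of 1]
    proof eventually_elim
      case (elim n)
      have "expectation (\<lambda>y. ln (Z n \<beta> h y)) / real n - f
          = expectation (\<lambda>y. ln (Z n \<beta> h y) / real n - f)"
        using int[OF elim] by (subst Bochner_Integration.integral_diff) (auto simp: prob_space)
      then show ?case by (simp add: integral_abs_bound)
    qed
  qed
  then show ?thesis by (simp add: LIM_zero_iff)
qed

lemma integrable_log_Z:
  assumes "is_quenched_free_energy P \<tau> M \<omega> \<beta> h f" "n \<ge> 1"
  shows "integrable M (\<lambda>y. ln (Z n \<beta> h y))"
proof -
  have "integrable M (\<lambda>y. ln (Z n \<beta> h y) / real n)"
    using assms unfolding is_quenched_free_energy_def by blast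
  from integrable_mult_left[OF this, of "real n"] show ?thesis using assms(2) by simp
qed

lemma expectation_log_Z_ge:
  assumes F: "is_quenched_free_energy P \<tau> M \<omega> \<beta> h f" and n: "n \<ge> 1" and l: "l \<in> compositions n"
  shows "expectation (\<lambda>y. ln (Z n \<beta> h y)) \<ge> ln (prod_list (map K l)) + h * real (length l)"
proof -
  have l0: "0 \<notin> set l" using l by (simp add: compositions_def)
  have S: "integrable M (\<lambda>y. \<Sum>j\<leftarrow>ps. \<beta> * \<omega> (int j) y + h)
      \<and> expectation (\<lambda>y. \<Sum>j\<leftarrow>ps. \<beta> * \<omega> (int j) y + h) = h * real (length ps)" for ps
    by (induction ps) (auto simp: integrable_omega mean prob_space algebra_simps)
  note S = S[of "partial_sums 0 l"]
  have "ln (prod_list (map K l)) + h * real (length l)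
      = expectation (\<lambda>y. ln (prod_list (map K l)) + (\<Sum>j\<leftarrow>partial_sums 0 l. \<beta> * \<omega> (int j) y + h))"
    using S by (subst Bochner_Integration.integral_add) (auto simp: prob_space)
  also have "\<dots> \<le> expectation (\<lambda>y. ln (Z n \<beta> h y))"
  proof (rule integral_mono)
    show "integrable M (\<lambda>y. ln (prod_list (map K l)) + (\<Sum>j\<leftarrow>partial_sums 0 l. \<beta> * \<omega> (int j) y + h))"
      using S by auto
    show "integrable M (\<lambda>y. ln (Z n \<beta> h y))" by (rule integrable_log_Z[OF F n])
    fix y
    let ?w = "prod_list (map K l) * exp (\<Sum>j\<leftarrow>partial_sums 0 l. \<beta> * \<omega> (int j) y + h)"
    have "ln ?w \<le> ln (Z n \<beta> h y)"
      using quenched_Z_ge[OF l, of \<beta> "\<lambda>k. \<omega> k y" h] prod_K_pos[OF l0] quenched_Z_pos[OF n] by simp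
    then show "ln (prod_list (map K l)) + (\<Sum>j\<leftarrow>partial_sums 0 l. \<beta> * \<omega> (int j) y + h) \<le> ln (Z n \<beta> h y)"
      using prod_K_pos[OF l0] by (simp add: ln_mult)
  qed
  finally show ?thesis .
qed

lemma single_jump_tendsto: "(\<lambda>n. (ln (K n) + c) / real n) \<longlonglongrightarrow> 0"
  using tendsto_add[OF K_log lim_const_over_n[of c]] by (simp add: add_divide_distrib)

text \<open>The trajectory that jumps from \<open>0\<close> to \<open>n\<close> in one step has a subexponential weight.\<close>

lemma quenched_free_energy_nonneg:
  assumes F: "is_quenched_free_energy P \<tau> M \<omega> \<beta> h f"
  shows "f \<ge> 0"
proof (rule LIMSEQ_le[OF single_jump_tendsto[of h] expectation_log_Z_tendsto[OF F]])
  have "(ln (K n) + h) / real n \<le> expectation (\<lambda>y. ln (Z n \<beta> h y)) / real n" if "n \<ge> 1" for n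
    using expectation_log_Z_ge[OF F that, of "[n]"] that
    by (intro divide_right_mono) (auto simp: compositions_def)
  then show "\<exists>N. \<forall>n\<ge>N. (ln (K n) + h) / real n \<le> expectation (\<lambda>y. ln (Z n \<beta> h y)) / real n"
    by blast
qed

text \<open>The trajectory that visits every site shows that the free energy is positive for large \<open>h\<close>, so
  that the supremum defining the quenched critical point is taken over a bounded set.\<close>

lemma quenched_free_energy_ge:
  assumes F: "is_quenched_free_energy P \<tau> M \<omega> \<beta> h f"
  shows "f \<ge> ln (K 1) + h"
proof (rule LIMSEQ_le_const[OF expectation_log_Z_tendsto[OF F]])
  have "ln (K 1) + h \<le> expectation (\<lambda>y. ln (Z n \<beta> h y)) / real n" if "n \<ge> 1" for n
  proof -
    have "replicate n 1 \<in> compositions n" by (simp add: compositions_def sum_list_replicate)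
    from expectation_log_Z_ge[OF F that this] K_pos[of 1]
    have "real n * (ln (K 1) + h) \<le> expectation (\<lambda>y. ln (Z n \<beta> h y))"
      by (simp add: prod_list_replicate ln_realpow algebra_simps)
    then show ?thesis using that by (simp add: field_simps)
  qed
  then show "\<exists>N. \<forall>n\<ge>N. ln (K 1) + h \<le> expectation (\<lambda>y. ln (Z n \<beta> h y)) / real n" by blast
qed

text \<open>If \<open>expectation (Z powr \<gamma>)\<close> stays bounded by \<open>1\<close>, then \<open>\<gamma> ln Z \<le> Z powr \<gamma> - 1\<close> has nonpositive
  expectation.\<close>

lemma quenched_free_energy_eq_0:
  assumes F: "is_quenched_free_energy P \<tau> M \<omega> \<beta> h f"
    and \<gamma>: "0 < \<gamma>" "\<gamma> \<le> 1"
    and density: "\<And>l. 0 \<notin> set l \<Longrightarrow> trajectory_variance l \<le> v * real (length l)"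
    and g: "\<And>n. (\<Sum>m=1..n. K m powr \<gamma> * exp ((\<gamma> * \<beta>)\<^sup>2 / 2 * v + \<gamma> * h)) \<le> 1"
  shows "f = 0"
proof (rule antisym[OF _ quenched_free_energy_nonneg[OF F]])
  have "expectation (\<lambda>y. ln (Z n \<beta> h y)) / real n \<le> 0" if n: "n \<ge> 1" for n
  proof -
    note fm = fractional_moment_le_1[OF \<gamma> density g, of n]
    have "\<gamma> * expectation (\<lambda>y. ln (Z n \<beta> h y)) = expectation (\<lambda>y. \<gamma> * ln (Z n \<beta> h y))"
      by simp
    also have "\<dots> \<le> expectation (\<lambda>y. Z n \<beta> h y powr \<gamma> - 1)"
    proof (rule integral_mono)
      fix y
      have "ln (Z n \<beta> h y powr \<gamma>) \<le> Z n \<beta> h y powr \<gamma> - 1"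
        using quenched_Z_pos[OF n] by (intro ln_le_minus_one) (simp add: less_imp_neq[symmetric])
      then show "\<gamma> * ln (Z n \<beta> h y) \<le> Z n \<beta> h y powr \<gamma> - 1"
        using quenched_Z_pos[OF n] by (simp add: ln_powr less_imp_neq[symmetric])
    qed (use fm(1) integrable_log_Z[OF F n] in auto)
    also have "\<dots> = expectation (\<lambda>y. Z n \<beta> h y powr \<gamma>) - 1"
      using fm(1) by (subst Bochner_Integration.integral_diff) (auto simp: prob_space)
    also have "\<dots> \<le> 0" using fm(2) by simp
    finally have "expectation (\<lambda>y. ln (Z n \<beta> h y)) \<le> 0" using \<gamma> by (simp add: mult_le_0_iff)
    then show ?thesis by (simp add: divide_le_0_iff)
  qed
  then show "f \<le> 0"
    by (intro LIMSEQ_le_const2[OF expectation_log_Z_tendsto[OF F]]) blast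
qed

section \<open>The annealed free energy\<close>

lemma annealed_Z_ge:
  assumes "l \<in> compositions n"
  shows "prod_list (map K l) * exp (\<beta>\<^sup>2 / 2 * trajectory_variance l + h * real (length l))
    \<le> annealed_Z P \<tau> M \<omega> n \<beta> h"
  unfolding annealed_Z_eq
  by (rule member_le_sum[OF assms _ finite_compositions])
    (auto simp: compositions_def intro!: mult_nonneg_nonneg less_imp_le[OF prod_K_pos])

lemma log_annealed_Z_ge:
  assumes l: "l \<in> compositions n"
  shows "ln (annealed_Z P \<tau> M \<omega> n \<beta> h)
    \<ge> ln (prod_list (map K l)) + (\<beta>\<^sup>2 / 2 * trajectory_variance l + h * real (length l))"
proof -
  have pos: "prod_list (map K l) > 0"
    using l by (intro prod_K_pos) (simp add: compositions_def)
  let ?w = "prod_list (map K l) * exp (\<beta>\<^sup>2 / 2 * trajectory_variance l + h * real (length l))"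
  have "?w > 0" using pos by simp
  with annealed_Z_ge[OF l, of \<beta> h] have "ln ?w \<le> ln (annealed_Z P \<tau> M \<omega> n \<beta> h)"
    by (simp only: ln_le_cancel_iff less_le_trans)
  then show ?thesis using pos by (simp add: ln_mult)
qed

lemma trajectory_variance_singleton: "trajectory_variance [n] = 1"
  by (simp add: trajectory_variance_def disorder_variance_def cov_self)

lemma annealed_free_energy_nonneg:
  assumes Fa: "is_annealed_free_energy P \<tau> M \<omega> \<beta> h f"
  shows "f \<ge> 0"
proof (rule LIMSEQ_le[OF single_jump_tendsto[of "\<beta>\<^sup>2 / 2 + h"] Fa[unfolded is_annealed_free_energy_def]])
  have "(ln (K n) + (\<beta>\<^sup>2 / 2 + h)) / real n \<le> ln (annealed_Z P \<tau> M \<omega> n \<beta> h) / real n" if "n \<ge> 1" for n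
    using log_annealed_Z_ge[of "[n]" n \<beta> h] that
    by (intro divide_right_mono) (auto simp: compositions_def trajectory_variance_singleton)
  then show "\<exists>N. \<forall>n\<ge>N. (ln (K n) + (\<beta>\<^sup>2 / 2 + h)) / real n \<le> ln (annealed_Z P \<tau> M \<omega> n \<beta> h) / real n"
    by blast
qed

lemma sum_K_le_1: "(\<Sum>m=1..n. K m) \<le> 1"
proof -
  have "(\<Sum>m=1..n. K m) = (\<Sum>i<n. K (Suc i))"
    by (rule sum.reindex_bij_witness[of _ Suc "\<lambda>m. m - 1"]) auto
  also have "\<dots> \<le> suminf (\<lambda>i. K (Suc i))"
    by (intro sum_le_suminf sums_summable[OF K_sum]) (auto intro!: K_nonneg)
  finally show ?thesis using sums_unique[OF K_sum] by simp
qed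

text \<open>The fractional moment bound with \<open>\<gamma> = 1\<close>. It makes the set defining the annealed critical
  point nonempty, without which its supremum would be meaningless.\<close>

lemma annealed_free_energy_eq_0:
  assumes Fa: "is_annealed_free_energy P \<tau> M \<omega> \<beta> h f"
    and density: "\<And>l. 0 \<notin> set l \<Longrightarrow> trajectory_variance l \<le> v * real (length l)"
    and h: "\<beta>\<^sup>2 / 2 * v + h \<le> 0"
  shows "f = 0"
proof (rule antisym[OF _ annealed_free_energy_nonneg[OF Fa]])
  have g: "(\<Sum>m=1..n. K m powr 1 * exp ((1 * \<beta>)\<^sup>2 / 2 * v + 1 * h)) \<le> 1" for n
  proof -
    have "(\<Sum>m=1..n. K m powr 1 * exp ((1 * \<beta>)\<^sup>2 / 2 * v + 1 * h)) \<le> (\<Sum>m=1..n. K m)"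
      using h K_nonneg by (intro sum_mono) (auto intro: mult_left_le)
    then show ?thesis using sum_K_le_1[of n] by linarith
  qed
  have "ln (annealed_Z P \<tau> M \<omega> n \<beta> h) / real n \<le> 0" if "n \<ge> 1" for n
  proof -
    have "annealed_Z P \<tau> M \<omega> n \<beta> h = (\<Sum>l\<in>compositions n. prod_list (map K l) powr 1
      * exp ((1 * \<beta>)\<^sup>2 / 2 * trajectory_variance l + 1 * h * real (length l)))"
      unfolding annealed_Z_eq
    proof (rule sum.cong[OF refl])
      fix l assume "l \<in> compositions n"
      then have "prod_list (map K l) > 0" by (intro prod_K_pos) (simp add: compositions_def)
      then show "prod_list (map K l) * exp (\<beta>\<^sup>2 / 2 * trajectory_variance l + h * real (length l))
        = prod_list (map K l) powr 1 * exp ((1 * \<beta>)\<^sup>2 / 2 * trajectory_variance l + 1 * h * real (length l))"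
        by simp
    qed
    also have "\<dots> \<le> 1" by (rule sum_K_powr_compositions_le_1[OF density g])
    finally have "annealed_Z P \<tau> M \<omega> n \<beta> h \<le> 1" .
    moreover have "annealed_Z P \<tau> M \<omega> n \<beta> h > 0"
    proof -
      have "[n] \<in> compositions n" using that by (simp add: compositions_def)
      from annealed_Z_ge[OF this, of \<beta> h] K_pos[OF that] show ?thesis
        by (auto intro: less_le_trans[OF mult_pos_pos[OF K_pos[OF that] exp_gt_zero]])
    qed
    ultimately show ?thesis by (simp add: divide_le_0_iff)
  qed
  then show "f \<le> 0"
    by (intro LIMSEQ_le_const2[OF Fa[unfolded is_annealed_free_energy_def]]) blast
qed

lemma periodic_trajectory:
  assumes l: "0 \<notin> set l" "l \<noteq> []" "hd l > q"
  shows "trajectory_variance (concat (replicate m l)) = real m * trajectory_variance l"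
proof (induction m)
  case 0
  show ?case by (simp add: trajectory_variance_def disorder_variance_def)
next
  case (Suc m)
  have "concat (replicate (Suc m) l) = concat (replicate m l) @ l"
    by (simp add: replicate_append_same[symmetric])
  moreover have "trajectory_variance (concat (replicate m l) @ l)
      = trajectory_variance (concat (replicate m l)) + trajectory_variance l"
    using l by (intro trajectory_variance_append) auto
  ultimately show ?case using Suc by (simp add: algebra_simps)
qed

text \<open>The periodic trajectory repeating the block \<open>l\<close> contributes a multiplicative weight to the
  annealed partition function; the limit is evaluated at multiples of the period.\<close>

lemma annealed_free_energy_ge:
  assumes Fa: "is_annealed_free_energy P \<tau> M \<omega> \<beta> h f"
    and l: "0 \<notin> set l" "l \<noteq> []" "hd l > q"
  shows "f \<ge> (ln (prod_list (map K l)) + (\<beta>\<^sup>2 / 2 * trajectory_variance l + h * real (length l)))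
    / real (sum_list l)"
proof -
  let ?r = "ln (prod_list (map K l)) + (\<beta>\<^sup>2 / 2 * trajectory_variance l + h * real (length l))"
  define p where "p = sum_list l"
  have p: "p > 0" using l by (cases l) (auto simp: p_def)
  have "(\<lambda>n. ln (annealed_Z P \<tau> M \<omega> n \<beta> h) / real n) \<longlonglongrightarrow> f"
    using Fa by (simp add: is_annealed_free_energy_def)
  moreover have "filterlim (\<lambda>m. m * p) sequentially sequentially"
    using p by (intro filterlim_subseq) (simp add: strict_mono_def)
  ultimately have lim: "(\<lambda>m. ln (annealed_Z P \<tau> M \<omega> (m * p) \<beta> h) / real (m * p)) \<longlonglongrightarrow> f"
    by (rule filterlim_compose)
  have "?r / real p \<le> ln (annealed_Z P \<tau> M \<omega> (m * p) \<beta> h) / real (m * p)" if m: "m \<ge> 1" for m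
  proof -
    let ?l = "concat (replicate m l)"
    have sum: "sum_list ?l = m * p" by (induction m) (auto simp: p_def)
    have prod: "prod_list (map K ?l) = prod_list (map K l) ^ m" by (induction m) auto
    have len: "length ?l = m * length l" by (induction m) auto
    have "?l \<in> compositions (m * p)" using l(1) sum by (auto simp: compositions_def)
    from log_annealed_Z_ge[OF this, of \<beta> h]
    have "real m * ?r \<le> ln (annealed_Z P \<tau> M \<omega> (m * p) \<beta> h)"
      unfolding prod len periodic_trajectory[OF l]
      using prod_K_pos[OF l(1)] by (simp add: ln_realpow algebra_simps)
    then have "real m * ?r / real (m * p) \<le> ln (annealed_Z P \<tau> M \<omega> (m * p) \<beta> h) / real (m * p)"
      by (rule divide_right_mono) simp
    then show ?thesis using m by simp
  qed
  then show ?thesis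
    unfolding p_def[symmetric] by (intro LIMSEQ_le_const[OF lim]) blast
qed

section \<open>Comparison of the critical points\<close>

text \<open>The largest variance of disorder per visited point that a trajectory can collect. The supremum
  need not be attained: with positive correlations it is approached by longer and longer runs.\<close>

definition max_variance_density :: real where
  "max_variance_density = (SUP l\<in>{l. 0 \<notin> set l \<and> l \<noteq> []}. trajectory_variance l / real (length l))"

lemma variance_density_bdd:
  "bdd_above ((\<lambda>l. trajectory_variance l / real (length l)) ` {l. 0 \<notin> set l \<and> l \<noteq> []})"
proof (rule bdd_aboveI2)
  fix l :: "nat list" assume "l \<in> {l. 0 \<notin> set l \<and> l \<noteq> []}"
  then show "trajectory_variance l / real (length l) \<le> 2 * real q + 1"
    using trajectory_variance_le[of l] by (simp add: divide_le_eq)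
qed

lemma trajectory_variance_le_max:
  assumes "0 \<notin> set l"
  shows "trajectory_variance l \<le> max_variance_density * real (length l)"
proof (cases "l = []")
  case False
  then have "trajectory_variance l / real (length l) \<le> max_variance_density"
    unfolding max_variance_density_def using assms by (intro cSUP_upper variance_density_bdd) auto
  then show ?thesis using False by (simp add: divide_le_eq)
qed (simp add: trajectory_variance_def disorder_variance_def)

lemma max_variance_density_ge_1: "max_variance_density \<ge> 1"
  using trajectory_variance_le_max[of "[Suc 0]"] by (simp add: trajectory_variance_singleton)

lemma exists_dense_block:
  assumes "v < max_variance_density"
  shows "\<exists>l. 0 \<notin> set l \<and> l \<noteq> [] \<and> hd l > q \<and> v < trajectory_variance l / real (length l)"
proof -
  have "[Suc 0] \<in> {l. 0 \<notin> set l \<and> l \<noteq> []}" by simp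
  then have ne: "{l :: nat list. 0 \<notin> set l \<and> l \<noteq> []} \<noteq> {}" by blast
  obtain l where l: "0 \<notin> set l" "l \<noteq> []" "v < trajectory_variance l / real (length l)"
    using iffD1[OF less_cSUP_iff[OF ne variance_density_bdd] assms[unfolded max_variance_density_def]]
    by auto
  then obtain m l' where l': "l = m # l'" by (cases l) auto
  show ?thesis
    using l trajectory_variance_delay[of m q l']
    by (intro exI[of _ "(m + q) # l'"]) (auto simp: l')
qed

text \<open>The bound is the value of \<open>h\<close> at which the fractional moment estimate is exactly balanced:
  the factor per visited point equals the inverse of the sum of the powers of \<open>K\<close>.\<close>

lemma quenched_critical_point_ge:
  assumes F: "\<And>h. is_quenched_free_energy P \<tau> M \<omega> \<beta> h (F \<beta> h)"
    and \<gamma>: "0 < \<gamma>" "\<gamma> \<le> 1" and sum: "summable (\<lambda>n. K (Suc n) powr \<gamma>)"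
  shows "critical_point F \<beta>
    \<ge> - \<gamma> * max_variance_density * \<beta>\<^sup>2 / 2 - ln (\<Sum>n. K (Suc n) powr \<gamma>) / \<gamma>" (is "_ \<ge> ?h")
proof -
  define C where "C = (\<Sum>n. K (Suc n) powr \<gamma>)"
  have "K (Suc 0) powr \<gamma> \<le> C"
    unfolding C_def using sum_le_suminf[OF sum, of "{0}"] by simp
  then have C: "C > 0" using K_pos[of 1] by (simp add: order_less_le_trans[of 0 "K (Suc 0) powr \<gamma>"])
  have "(\<gamma> * \<beta>)\<^sup>2 / 2 * max_variance_density + \<gamma> * ?h = - ln C"
    using \<gamma> by (simp add: C_def field_simps power2_eq_square)
  then have e: "exp ((\<gamma> * \<beta>)\<^sup>2 / 2 * max_variance_density + \<gamma> * ?h) = 1 / C"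
    using C by (simp add: exp_minus inverse_eq_divide)
  have g: "(\<Sum>m=1..n. K m powr \<gamma> * exp ((\<gamma> * \<beta>)\<^sup>2 / 2 * max_variance_density + \<gamma> * ?h)) \<le> 1" for n
  proof -
    have "(\<Sum>m=1..n. K m powr \<gamma>) = (\<Sum>i<n. K (Suc i) powr \<gamma>)"
      by (rule sum.reindex_bij_witness[of _ Suc "\<lambda>m. m - 1"]) auto
    also have "\<dots> \<le> C" unfolding C_def by (intro sum_le_suminf sum) auto
    finally show ?thesis unfolding e sum_distrib_right[symmetric] using C by simp
  qed
  have "F \<beta> ?h = 0"
    by (rule quenched_free_energy_eq_0[OF F \<gamma> trajectory_variance_le_max g])
  moreover have "bdd_above {h. F \<beta> h = 0}"
  proof (rule bdd_aboveI)
    fix h assume "h \<in> {h. F \<beta> h = 0}"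
    then show "h \<le> - ln (K 1)" using quenched_free_energy_ge[OF F[of h]] by simp
  qed
  ultimately show ?thesis
    unfolding critical_point_def by (intro cSup_upper) auto
qed

lemma annealed_critical_point_le:
  assumes Fa: "\<And>h. is_annealed_free_energy P \<tau> M \<omega> \<beta> h (Fa \<beta> h)"
    and l: "0 \<notin> set l" "l \<noteq> []" "hd l > q"
  shows "critical_point Fa \<beta>
    \<le> - (trajectory_variance l / real (length l)) * \<beta>\<^sup>2 / 2 - ln (prod_list (map K l)) / real (length l)"
  unfolding critical_point_def
proof (rule cSup_least)
  have "Fa \<beta> (- (\<beta>\<^sup>2 / 2 * max_variance_density)) = 0"
    by (rule annealed_free_energy_eq_0[OF Fa trajectory_variance_le_max]) auto
  then show "{h. Fa \<beta> h = 0} \<noteq> {}" by blast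
next
  fix h assume "h \<in> {h. Fa \<beta> h = 0}"
  then have "(ln (prod_list (map K l)) + (\<beta>\<^sup>2 / 2 * trajectory_variance l + h * real (length l)))
      / real (sum_list l) \<le> 0"
    using annealed_free_energy_ge[OF Fa l, of h] by simp
  moreover have "real (sum_list l) > 0" using l by (cases l) auto
  ultimately have "ln (prod_list (map K l)) + (\<beta>\<^sup>2 / 2 * trajectory_variance l + h * real (length l)) \<le> 0"
    by (simp only: pos_divide_le_eq mult_zero_left)
  moreover have "real (length l) > 0" using l by simp
  ultimately show "h \<le> - (trajectory_variance l / real (length l)) * \<beta>\<^sup>2 / 2
      - ln (prod_list (map K l)) / real (length l)"
    by (simp add: field_simps)
qed

end

theorem theorem2p1:
  fixes P :: "'a measure" and \<tau> :: "nat \<Rightarrow> 'a \<Rightarrow> nat"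
    and K :: "nat \<Rightarrow> real" and L :: "real \<Rightarrow> real" and \<alpha> :: real
    and M :: "'b measure" and \<omega> :: "int \<Rightarrow> 'b \<Rightarrow> real" and q :: nat
    and F Fa :: "real \<Rightarrow> real \<Rightarrow> real"
  assumes alpha: "0 < \<alpha>" "\<alpha> < 1/2"
    and L: "slowly_varying L"
    and K: "\<And>n. n \<ge> 1 \<Longrightarrow> K n = L (real n) * real n powr (- (1 + \<alpha>))"
    and K_sum: "(\<lambda>n. K (Suc n)) sums 1"
    and renewal: "renewal_process P \<tau> K"
    and M: "prob_space M"
    and gaussian: "gaussian_process M \<omega>"
    and stationary: "stationary_process M \<omega>"
    and mean: "\<And>n. prob_space.expectation M (\<omega> n) = 0"
    and variance: "\<And>n. prob_space.variance M (\<omega> n) = 1"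
    and q: "q \<ge> 1"
    and finite_range: "\<And>n. n > int q \<Longrightarrow> covariance M (\<omega> 0) (\<omega> n) = 0"
    and F: "\<And>\<beta> h. \<beta> \<ge> 0 \<Longrightarrow> is_quenched_free_energy P \<tau> M \<omega> \<beta> h (F \<beta> h)"
    and Fa: "\<And>\<beta> h. \<beta> \<ge> 0 \<Longrightarrow> is_annealed_free_energy P \<tau> M \<omega> \<beta> h (Fa \<beta> h)"
  shows "\<exists>\<beta>0::real. \<forall>\<beta>>\<beta>0. \<beta> \<ge> 0 \<longrightarrow> critical_point F \<beta> > critical_point Fa \<beta>"
proof -
  interpret prob_space M by (rule M)
  interpret pinning_model P \<tau> K M \<omega> q
  proof unfold_locales
    show "K n > 0" if "n \<ge> 1" for n
      using that L by (simp add: K slowly_varying_def)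
    show "(\<lambda>n. ln (K n) / real n) \<longlonglongrightarrow> 0"
      by (rule regularly_varying_log_tendsto_0[OF L K])
  qed (fact renewal gaussian stationary mean variance finite_range K_sum)+
  obtain \<gamma> where \<gamma>: "0 < \<gamma>" "\<gamma> < 1" and sum: "summable (\<lambda>n. K (Suc n) powr \<gamma>)"
    using regularly_varying_powr_summable[OF L alpha(1) K] by auto
  \<comment> \<open>Since \<open>\<gamma> < 1\<close>, it is enough to approximate the maximal density up to a factor.\<close>
  have "\<gamma> * max_variance_density < max_variance_density"
    using \<gamma> max_variance_density_ge_1 by simp
  then obtain l where l: "0 \<notin> set l" "l \<noteq> []" "hd l > q"
    and dense: "\<gamma> * max_variance_density < trajectory_variance l / real (length l)"
    using exists_dense_block by blast
  \<comment> \<open>The two bounds on the critical points differ by at least \<open>\<delta> \<beta>\<^sup>2 / 2 - D\<close>, where \<open>\<delta>\<close> and \<open>D\<close> do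
    not depend on \<open>\<beta>\<close>.\<close>
  define \<delta> where "\<delta> = trajectory_variance l / real (length l) - \<gamma> * max_variance_density"
  define D where "D = ln (\<Sum>n. K (Suc n) powr \<gamma>) / \<gamma> - ln (prod_list (map K l)) / real (length l)"
  have \<delta>: "\<delta> > 0" using dense by (simp add: \<delta>_def)
  show ?thesis
  proof (intro exI[of _ "max 1 (2 * D / \<delta>)"] allI impI)
    fix \<beta> :: real assume \<beta>: "max 1 (2 * D / \<delta>) < \<beta>" "\<beta> \<ge> 0"
    have "2 * D / \<delta> < \<beta>" using \<beta> by simp
    also have "\<beta> \<le> \<beta>\<^sup>2" using \<beta> by (simp add: power2_eq_square)
    finally have "D < \<delta> * \<beta>\<^sup>2 / 2" using \<delta> by (simp add: field_simps)
    then have "- (trajectory_variance l / real (length l)) * \<beta>\<^sup>2 / 2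
          - ln (prod_list (map K l)) / real (length l)
        < - \<gamma> * max_variance_density * \<beta>\<^sup>2 / 2 - ln (\<Sum>n. K (Suc n) powr \<gamma>) / \<gamma>"
      by (simp add: \<delta>_def D_def algebra_simps diff_divide_distrib)
    then show "critical_point Fa \<beta> < critical_point F \<beta>"
      using annealed_critical_point_le[where Fa=Fa, OF Fa[OF \<beta>(2)] l]
        quenched_critical_point_ge[where F=F, OF F[OF \<beta>(2)] \<gamma>(1) less_imp_le[OF \<gamma>(2)] sum]
      by linarith
  qed
qed

end
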